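(* Let $G$ be a $1$-planar chordal graph that is not isomorphic to $K_6$. Then $\kappa(G)\le 4$. Moreover, if $\kappa(G)=4$, then $G$ is a $4$-tree.
   Context: All graphs are finite, simple and connected. A drawing of a graph in the plane maps vertices to distinct points and each edge to a continuous arc joining its endpoints; all drawings are good: no edge crosses itself, no two edges cross more than once, and no two edges incident with a common vertex cross. A graph is $1$-planar if it has a drawing in which every edge is crossed at most once. A graph is chordal if it has no induced cycle of length at least four. For a non-complete graph $G$, the connectivity $\kappa(G)$ is the minimum size of a vertex set whose removal disconnects $G$; for a complete graph $\kappa(G)=|V(G)|-1$. A vertex $u$ is simplicial if $d(u)=0$ or its neighbourhood is a clique. The $k$-trees are defined recursively: $K_k$ is the smallest $k$-tree, and a graph $G$ of order $n\ge k+1$ is a $k$-tree if it has a simplicial vertex $u$ of degree $k$ such that $G-u$ is a $k$-tree. *)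

theory Defs
  imports "HOL-Analysis.Analysis" "Graph_Theory.Graph_Theory"
begin

text \<open>
  A finite simple graph is a symmetric digraph in the sense of the locale \<^locale>\<open>graph\<close>: each
  undirected edge is a pair of opposite arcs.
\<close>

definition edges :: "('a, 'b) pre_digraph \<Rightarrow> 'a set set" where
  "edges G = {{u, v} | u v. u \<rightarrow>\<^bsub>G\<^esub> v}"

definition neighbourhood :: "('a, 'b) pre_digraph \<Rightarrow> 'a \<Rightarrow> 'a set" where
  "neighbourhood G u = {v. u \<rightarrow>\<^bsub>G\<^esub> v}"

definition degree :: "('a, 'b) pre_digraph \<Rightarrow> 'a \<Rightarrow> nat" where
  "degree G u = card (neighbourhood G u)"

definition clique :: "('a, 'b) pre_digraph \<Rightarrow> 'a set \<Rightarrow> bool" where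
  "clique G S \<longleftrightarrow> S \<subseteq> verts G \<and> (\<forall>u\<in>S. \<forall>v\<in>S. u \<noteq> v \<longrightarrow> u \<rightarrow>\<^bsub>G\<^esub> v)"

definition simplicial :: "('a, 'b) pre_digraph \<Rightarrow> 'a \<Rightarrow> bool" where
  "simplicial G u \<longleftrightarrow> u \<in> verts G \<and> (degree G u = 0 \<or> clique G (neighbourhood G u))"

inductive k_tree :: "nat \<Rightarrow> ('a, 'b) pre_digraph \<Rightarrow> bool" for k where
  complete: "K\<^bsub>k\<^esub> G \<Longrightarrow> k_tree k G"
| extend: "\<lbrakk>graph G; card (verts G) \<ge> k + 1; simplicial G u; degree G u = k;
            k_tree k (pre_digraph.del_vert G u)\<rbrakk> \<Longrightarrow> k_tree k G"

text \<open>
  The vertices of a cycle \<open>p\<close> (a list of arcs) are the tails of its arcs, and its length is the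
  length of the list. A cycle is induced if the graph has no further edge between its vertices.
  The library's cycles include the degenerate closed walk along an edge and back, of length 2.
\<close>

definition induced_cycle :: "('a, 'b) pre_digraph \<Rightarrow> 'b awalk \<Rightarrow> bool" where
  "induced_cycle G p \<longleftrightarrow> pre_digraph.cycle G p \<and>
     (\<forall>u \<in> tail G ` set p. \<forall>v \<in> tail G ` set p.
        u \<rightarrow>\<^bsub>G\<^esub> v \<longrightarrow> (\<exists>a \<in> set p. arc_to_ends G a \<in> {(u, v), (v, u)}))"

definition chordal :: "('a, 'b) pre_digraph \<Rightarrow> bool" where
  "chordal G \<longleftrightarrow> \<not> (\<exists>p. induced_cycle G p \<and> length p \<ge> 4)"

text \<open>
  In the library the graph without vertices is not connected; separating sets are therefore
  proper subsets of the vertex set. The name \<open>connected\<close> needs qualification because of the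
  topological notion.
\<close>

definition separating :: "('a, 'b) pre_digraph \<Rightarrow> 'a set \<Rightarrow> bool" where
  "separating G S \<longleftrightarrow> S \<subset> verts G \<and> \<not> Digraph_Component.connected (G \<restriction> (verts G - S))"

definition connectivity :: "('a, 'b) pre_digraph \<Rightarrow> nat" where
  "connectivity G =
     (if K\<^bsub>card (verts G)\<^esub> G then card (verts G) - 1
      else (LEAST k. \<exists>S. separating G S \<and> card S = k))"

text \<open>
  Drawings in the plane, modelled by the type \<^typ>\<open>complex\<close>: \<open>pos\<close> places the vertices, and \<open>\<gamma>\<close>
  assigns a curve to each edge. As usual for drawings, a curve contains no vertex other than
  the ends of its edge. That no edge crosses itself is expressed by the library predicate
  \<^const>\<open>arc\<close>, an injective path.
\<close>

definition drawing ::
    "('a, 'b) pre_digraph \<Rightarrow> ('a \<Rightarrow> complex) \<Rightarrow> ('a set \<Rightarrow> real \<Rightarrow> complex) \<Rightarrow> bool" where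
  "drawing G pos \<gamma> \<longleftrightarrow> inj_on pos (verts G) \<and>
     (\<forall>e \<in> edges G. arc (\<gamma> e) \<and> {pathstart (\<gamma> e), pathfinish (\<gamma> e)} = pos ` e \<and>
        path_image (\<gamma> e) \<inter> pos ` verts G = pos ` e)"

text \<open>
  Every common point of two distinct edges other than a vertex counts as a crossing. An edge
  through a point that it shares with several other edges is crossed by each of them.
\<close>

definition crossing_points ::
    "('a \<Rightarrow> complex) \<Rightarrow> ('a set \<Rightarrow> real \<Rightarrow> complex) \<Rightarrow> 'a set \<Rightarrow> 'a set \<Rightarrow> complex set" where
  "crossing_points pos \<gamma> e f = (path_image (\<gamma> e) - pos ` e) \<inter> (path_image (\<gamma> f) - pos ` f)"

definition good_drawing ::
    "('a, 'b) pre_digraph \<Rightarrow> ('a \<Rightarrow> complex) \<Rightarrow> ('a set \<Rightarrow> real \<Rightarrow> complex) \<Rightarrow> bool" where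
  "good_drawing G pos \<gamma> \<longleftrightarrow> drawing G pos \<gamma> \<and>
     (\<forall>e \<in> edges G. \<forall>f \<in> edges G. e \<noteq> f \<longrightarrow>
        finite (crossing_points pos \<gamma> e f) \<and> card (crossing_points pos \<gamma> e f) \<le> 1 \<and>
        (e \<inter> f \<noteq> {} \<longrightarrow> crossing_points pos \<gamma> e f = {}))"

definition crossings ::
    "('a, 'b) pre_digraph \<Rightarrow> ('a \<Rightarrow> complex) \<Rightarrow> ('a set \<Rightarrow> real \<Rightarrow> complex) \<Rightarrow> 'a set
      \<Rightarrow> ('a set \<times> complex) set" where
  "crossings G pos \<gamma> e = (SIGMA f : edges G - {e}. crossing_points pos \<gamma> e f)"

definition one_planar :: "('a, 'b) pre_digraph \<Rightarrow> bool" where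
  "one_planar G \<longleftrightarrow> (\<exists>pos \<gamma>. good_drawing G pos \<gamma> \<and>
     (\<forall>e \<in> edges G. finite (crossings G pos \<gamma> e) \<and> card (crossings G pos \<gamma> e) \<le> 1))"

end

theory Submission
  imports Defs "HOL-Complex_Analysis.Winding_Numbers"
begin

text \<open>
  The topological input is the nonplanarity of $K_{3,3}$. Let $\<theta>$ be a theta curve with arcs
  $L_1, L_2, L_3$. For a point off $\<theta>$ the winding numbers of the three loops (suitably oriented)
  sum to 0, while each is $\pm 1$ inside and 0 outside the loop; comparing the possible patterns shows
  that no connected set off $\<theta>$ can accumulate at interior points of all three arcs. Two vertices
  of one side of a drawn $K_{3,3}$ would give such a $\<theta>$, and the star of the third such a set.

  In a 1-planar drawing each crossing can serve as a vertex of $K_{3,3}$ that is adjacent to the four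
  ends of the crossing edges. With this, two different crossings cannot share three ends that
  have a further common neighbour, and $K_6$ has exactly one drawing up to the choice of labels: a
  prism whose three quadrangles carry the crossings. A seventh vertex adjacent to four of the six
  cannot be added to it.

  A chordal graph without separating sets of size less than 4 is taken apart at simplicial vertices, which have
  degree at least 4. Degree 6 or more produces $K_7$. If the degree is 5, the vertex and its
  neighbours form a $K_6$, and since the rest is a 4-tree, another vertex is adjacent to at least four of
  these neighbours. Both are excluded, so the graph is a 4-tree or $K_6$.
\<close>

section \<open>Nonplanarity of the complete bipartite graph on 3 + 3 vertices\<close>

text \<open>Counting edges cannot exclude a seventh vertex with four neighbours in a K6: a 1-planar
  graph on 7 vertices may have 4 * 7 - 8 = 20 edges, and this one has 19. The shape of the drawing
  of K6 has to be used. It is found without planarising the drawing: an edge that takes part in a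
  crossing admits no second one, so a star centred at a crossing is crossed by no further edge, and
  in a K33 with such a centre only the two other stars can conflict. A crossing thus forces another,
  until an edge would be crossed twice or two crossings would share too many ends. Winding numbers
  fit the topological part because they add along arcs: the three loops of a theta curve can be
  compared without knowing which arc lies in the middle.\<close>

definition link :: "complex \<Rightarrow> complex \<Rightarrow> complex set \<Rightarrow> bool" where
  "link u v P \<longleftrightarrow> (\<exists>g. arc g \<and> pathstart g = u \<and> pathfinish g = v \<and> path_image g = P)"

lemma link_neq: "link u v P \<Longrightarrow> u \<noteq> v"
  unfolding link_def using arc_distinct_ends by metis

lemma link_ends: "link u v P \<Longrightarrow> u \<in> P \<and> v \<in> P"
  unfolding link_def by auto

lemma link_sym: "link u v P \<Longrightarrow> link v u P"
  unfolding link_def by (metis arc_reversepath path_image_reversepath pathfinish_reversepath pathstart_reversepath)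

lemma link_join:
  assumes "link u v P" "link v w Q" "P \<inter> Q = {v}"
  shows "link u w (P \<union> Q)"
proof -
  obtain g h where "arc g" "pathstart g = u" "pathfinish g = v" "path_image g = P"
    "arc h" "pathstart h = v" "pathfinish h = w" "path_image h = Q"
    using assms unfolding link_def by metis
  then show ?thesis using assms(3) unfolding link_def
    by (intro exI[of _ "g +++ h"]) (auto simp: path_image_join intro!: arc_join)
qed

lemma link_split:
  assumes "link u v P" "x \<in> P" "x \<noteq> u" "x \<noteq> v"
  obtains A B where "link u x A" "link x v B" "A \<union> B = P" "A \<inter> B = {x}"
proof -
  obtain g where g: "arc g" "pathstart g = u" "pathfinish g = v" "path_image g = P"
    using assms unfolding link_def by metis
  obtain t where t: "t \<in> {0..1}" "g t = x" using assms(2) g by (auto simp: path_image_def)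
  have t01: "t \<noteq> 0" "t \<noteq> 1" using t g assms(3,4) by (auto simp: pathstart_def pathfinish_def)
  have inj: "inj_on g {0..1}" using g(1) by (auto simp: arc_def)
  have A: "path_image (subpath 0 t g) = g ` {0..t}" and B: "path_image (subpath t 1 g) = g ` {t..1}"
    using t by (simp_all add: path_image_subpath)
  have "g ` {0..t} \<union> g ` {t..1} = P" using g(4) t(1) unfolding path_image_def
    by (simp add: ivl_disj_un_two_touch(4) flip: image_Un)
  moreover have "g ` {0..t} \<inter> g ` {t..1} = g ` ({0..t} \<inter> {t..1})"
    using inj_on_image_Int[OF inj, of "{0..t}" "{t..1}"] t(1) by auto
  moreover have "{0..t} \<inter> {t..1} = {t}" using t(1) by auto
  moreover have "link u x (g ` {0..t})" unfolding link_def
    using A t t01 g arc_subpath_arc[OF g(1), of 0 t]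
    by (intro exI[of _ "subpath 0 t g"]) (auto simp: pathstart_def pathfinish_def subpath_def)
  moreover have "link x v (g ` {t..1})" unfolding link_def
    using B t t01 g arc_subpath_arc[OF g(1), of t 1]
    by (intro exI[of _ "subpath t 1 g"]) (auto simp: pathstart_def pathfinish_def subpath_def)
  ultimately show thesis
    using that[of "g ` {0..t}" "g ` {t..1}"] t by simp
qed

lemma link_connected: "link u v P \<Longrightarrow> topological_space_class.connected P"
  unfolding link_def using connected_path_image arc_imp_path by metis

lemma link_interior:
  assumes "link u v P"
  shows "topological_space_class.connected (P - {u, v})"
  using assms unfolding link_def
  by (metis arc_imp_simple_path connected_simple_path_endless)

lemma link_compact: "link u v P \<Longrightarrow> compact P"
  unfolding link_def using compact_path_image arc_imp_path by metis

text \<open>A leg of a star without its foot stays connected and accumulates at the foot. In this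
  way a star comes close to a curve through its feet without touching it.\<close>

lemma link_minus_end:
  assumes "link u v P"
  shows "topological_space_class.connected (P - {v})" "v \<in> closure (P - {v})"
proof -
  obtain g where g: "arc g" "pathstart g = u" "pathfinish g = v" "path_image g = P"
    using assms unfolding link_def by metis
  have "P - {v} = g ` {0..<1}"
  proof -
    have inj: "inj_on g {0..1}" using g(1) by (auto simp: arc_def)
    have "P = g ` {0..1}" using g by (simp add: path_image_def)
    moreover have "{0..1::real} - {1} = {0..<1}" by auto
    moreover have "v = g 1" using g by (simp add: pathfinish_def)
    ultimately show ?thesis using inj_on_image_set_diff[OF inj, of "{0..1}" "{1}"] by auto
  qed
  moreover have cg: "continuous_on {0..1} g" using g(1) by (auto simp: arc_def path_def)
  ultimately show "topological_space_class.connected (P - {v})"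
    by (metis atLeastLessThan_subseteq_atLeastAtMost_iff connected_Ico connected_continuous_image continuous_on_subset order_refl)
  show "v \<in> closure (P - {v})"
  proof -
    have "P - {v} \<noteq> {}" using link_ends link_neq assms by blast
    moreover have "topological_space_class.connected P" by (rule link_connected[OF assms])
    moreover have "P \<noteq> {v}" using link_ends link_neq assms by blast
    ultimately have "v islimpt P" using connected_imp_perfect link_ends[OF assms] by (metis singletonD singletonI)
    then show ?thesis by (metis closure_def islimpt_punctured Un_iff mem_Collect_eq)
  qed
qed

section \<open>Theta curves and the sides of their loops\<close>

lemma inside_connected:
  assumes "topological_space_class.connected T" "T \<inter> J = {}" "x \<in> T" "y \<in> T" "x \<in> inside J"
  shows "y \<in> inside J"
  using assms inside_same_component connected_component_of_subset
  by (metis connected_component_def disjoint_eq_subset_Compl)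

lemma theta_loop:
  assumes "arc g" "arc h" "pathstart g = pathstart h" "pathfinish g = pathfinish h"
    "path_image g \<inter> path_image h = {pathstart g, pathfinish g}"
  shows "simple_path (g +++ reversepath h)" "pathfinish (g +++ reversepath h) = pathstart (g +++ reversepath h)"
    "path_image (g +++ reversepath h) = path_image g \<union> path_image h"
  using assms by (auto intro!: simple_path_join_loop simp: path_image_join arc_reversepath)

text \<open>The outside of \<open>L1 \<union> L2\<close> together with the boundary point
  \<open>b1\<close> is connected and misses \<open>L2 \<union> L3\<close>. Since \<open>b1\<close>
  is inside that second loop, an unbounded set would lie in a bounded one.\<close>

lemma theta_two_inside:
  fixes c :: "real \<Rightarrow> complex"
  assumes lo: "simple_path c" "pathfinish c = pathstart c" "path_image c = L1 \<union> L2"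
    and L3: "L3 - {a, b} \<subseteq> inside (L1 \<union> L2)" and ab: "a \<in> L1" "b \<in> L1"
    and b1: "b1 \<in> L1" "b1 \<notin> L2" "b1 \<notin> L3" "b1 \<in> inside (L2 \<union> L3)"
    and bd: "bounded (L2 \<union> L3)"
  shows False
proof -
  note J = Jordan_inside_outside[OF lo(1,2), unfolded lo(3)]
  let ?O = "outside (L1 \<union> L2)"
  have "b1 \<in> closure ?O" using J b1(1) by (auto simp: closure_Un_frontier)
  then have con: "topological_space_class.connected (insert b1 ?O)"
    using J connected_intermediate_closure[of ?O "insert b1 ?O"] closure_subset[of ?O] by blast
  moreover have "?O \<inter> (L1 \<union> L2) = {}" by (simp add: outside_no_overlap)
  moreover have "?O \<inter> inside (L1 \<union> L2) = {}" using J by (simp add: Int_commute)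
  ultimately have "insert b1 ?O \<inter> (L2 \<union> L3) = {}" using L3 b1(2,3) ab by blast
  then have "?O \<subseteq> inside (L2 \<union> L3)"
    using inside_connected[OF con, of "L2 \<union> L3" b1] b1(4) by blast
  then show False using J bd bounded_inside bounded_subset by metis
qed

text \<open>Adding \<open>b1\<close> or \<open>b2\<close> to the inside of
  \<open>L1 \<union> L2\<close> keeps it connected and off one of the other loops, so all of it
  inherits the side of that point. Any \<open>p\<close> in it is then inside exactly one of the
  three loops.\<close>

lemma theta_all_outside:
  fixes c :: "real \<Rightarrow> complex"
  assumes lo: "simple_path c" "pathfinish c = pathstart c" "path_image c = L1 \<union> L2"
    and L3: "(L3 - {a, b}) \<inter> inside (L1 \<union> L2) = {}" and ab: "a \<in> L1" "b \<in> L1"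
    and b1: "b1 \<in> L1" "b1 \<notin> L2" "b1 \<notin> L3" "b1 \<notin> inside (L2 \<union> L3)"
    and b2: "b2 \<in> L2" "b2 \<notin> L1" "b2 \<notin> L3" "b2 \<notin> inside (L1 \<union> L3)"
  obtains p where "p \<in> inside (L1 \<union> L2)" "p \<notin> L1 \<union> L2 \<union> L3" "p \<notin> inside (L2 \<union> L3)" "p \<notin> inside (L1 \<union> L3)"
proof -
  note J = Jordan_inside_outside[OF lo(1,2), unfolded lo(3)]
  let ?I = "inside (L1 \<union> L2)"
  have con: "topological_space_class.connected (insert x ?I)" if "x \<in> L1 \<union> L2" for x
  proof -
    have "x \<in> closure ?I" using J that by (auto simp: closure_Un_frontier)
    then show ?thesis
      using J connected_intermediate_closure[of ?I "insert x ?I"] closure_subset[of ?I] by blast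
  qed
  obtain p where p: "p \<in> ?I" using J by blast
  have dis: "?I \<inter> (L1 \<union> L2) = {}" by (simp add: inside_no_overlap)
  then have dis3: "?I \<inter> L3 = {}" using L3 ab by blast
  have "p \<notin> inside (L2 \<union> L3)"
    using inside_connected[OF con[of b1], of "L2 \<union> L3" p b1] b1 p dis dis3 by blast
  moreover have "p \<notin> inside (L1 \<union> L3)"
    using inside_connected[OF con[of b2], of "L1 \<union> L3" p b2] b2 p dis dis3 by blast
  ultimately show thesis using that p dis dis3 by blast
qed


text \<open>The winding number of a loop is the difference of those of its two arcs. It vanishes
  outside, so the arcs of two of the loops agree at \<open>z\<close>; hence so do those of the
  third, while inside a simple loop the difference has modulus 1.\<close>

lemma theta_winding:
  fixes a b z :: complex
  assumes g: "arc g1" "arc g2" "arc g3" "pathstart g1 = a" "pathstart g2 = a" "pathstart g3 = a"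
    "pathfinish g1 = b" "pathfinish g2 = b" "pathfinish g3 = b"
    and I: "path_image g1 \<inter> path_image g2 = {a, b}" "path_image g1 \<inter> path_image g3 = {a, b}"
      "path_image g2 \<inter> path_image g3 = {a, b}"
    and z: "z \<notin> path_image g1 \<union> path_image g2 \<union> path_image g3"
    and out: "z \<notin> inside (path_image g1 \<union> path_image g3)" "z \<notin> inside (path_image g2 \<union> path_image g3)"
  shows "z \<notin> inside (path_image g1 \<union> path_image g2)"
proof
  assume ins: "z \<in> inside (path_image g1 \<union> path_image g2)"
  have ng: "winding_number g z = winding_number h z"
    if "arc g" "arc h" "pathstart g = a" "pathstart h = a" "pathfinish g = b" "pathfinish h = b"
      "path_image g \<inter> path_image h = {a, b}" "z \<notin> path_image g \<union> path_image h"
      "z \<notin> inside (path_image g \<union> path_image h)" for g h :: "real \<Rightarrow> complex"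
  proof -
    have "z \<in> outside (path_image g \<union> path_image h)"
      using that(8,9) inside_Un_outside[of "path_image g \<union> path_image h"] by blast
    then have "winding_number (g +++ reversepath h) z = 0"
      using theta_loop[of g h] that by (intro winding_number_zero_in_outside) (auto simp: simple_path_imp_path)
    then show ?thesis
      using that by (simp add: winding_number_join winding_number_reversepath arc_imp_path)
  qed
  have "winding_number g1 z = winding_number g2 z"
    using ng[of g1 g3] ng[of g2 g3] g I z out by simp
  then have "winding_number (g1 +++ reversepath g2) z = 0"
    using g z by (simp add: winding_number_join winding_number_reversepath arc_imp_path)
  moreover have "cmod (winding_number (g1 +++ reversepath g2) z) = 1"
    using theta_loop[of g1 g2] g I ins by (intro simple_closed_path_norm_winding_number_inside) auto
  ultimately show False by simp
qed

text \<open>Each open arc forms a connected set with \<open>W\<close> that avoids the loop of the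
  other two, so one point \<open>w\<close> of \<open>W\<close> tells on which side of that loop the
  arc lies. Every pattern of sides leads to a contradiction.\<close>

lemma theta_faces:
  assumes L: "link a b L1" "link a b L2" "link a b L3"
    and I: "L1 \<inter> L2 = {a, b}" "L1 \<inter> L3 = {a, b}" "L2 \<inter> L3 = {a, b}"
    and bj: "b1 \<in> L1 - {a, b}" "b2 \<in> L2 - {a, b}" "b3 \<in> L3 - {a, b}"
    and W: "topological_space_class.connected W" "W \<inter> (L1 \<union> L2 \<union> L3) = {}"
    and cl: "b1 \<in> closure W" "b2 \<in> closure W" "b3 \<in> closure W"
  shows False
proof -
  obtain g1 g2 g3 where g: "arc g1" "arc g2" "arc g3"
      "pathstart g1 = a" "pathstart g2 = a" "pathstart g3 = a"
      "pathfinish g1 = b" "pathfinish g2 = b" "pathfinish g3 = b"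
    and im: "path_image g1 = L1" "path_image g2 = L2" "path_image g3 = L3"
    using L unfolding link_def by metis
  note I' = I[folded im]
  obtain w where w: "w \<in> W" using cl(1) by (metis closure_empty ex_in_conv)
  have side: "x \<in> inside J \<longleftrightarrow> w \<in> inside J"
    if "link a b L" "c \<in> L - {a, b}" "c \<in> closure W" "W \<inter> J = {}" "L \<inter> J \<subseteq> {a, b}" "x \<in> L - {a, b}" for x c L J
  proof -
    have "topological_space_class.connected (insert c W)"
      using connected_intermediate_closure[OF W(1), of "insert c W"] closure_subset that(3) by blast
    then have "topological_space_class.connected (insert c W \<union> (L - {a, b}))"
      using link_interior[OF that(1)] that(2) by (intro connected_Un) auto
    moreover have "(insert c W \<union> (L - {a, b})) \<inter> J = {}" using that by blast
    ultimately show ?thesis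
      using inside_connected[of "insert c W \<union> (L - {a, b})" J] that(6) w by blast
  qed
  have s1: "x \<in> inside (L2 \<union> L3) \<longleftrightarrow> w \<in> inside (L2 \<union> L3)" if "x \<in> L1 - {a, b}" for x
    by (rule side[OF L(1) bj(1) cl(1) _ _ that]) (use W(2) I in auto)
  have s2: "x \<in> inside (L1 \<union> L3) \<longleftrightarrow> w \<in> inside (L1 \<union> L3)" if "x \<in> L2 - {a, b}" for x
    by (rule side[OF L(2) bj(2) cl(2) _ _ that]) (use W(2) I in auto)
  have s3: "x \<in> inside (L1 \<union> L2) \<longleftrightarrow> w \<in> inside (L1 \<union> L2)" if "x \<in> L3 - {a, b}" for x
    by (rule side[OF L(3) bj(3) cl(3) _ _ that]) (use W(2) I in auto)
  have wn: "w \<notin> L1 \<union> L2 \<union> L3" using W(2) w by blast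
  have bd: "bounded (L \<union> L')" if "link a b L" "link a b L'" for L L'
    using that by (simp add: compact_imp_bounded link_compact)
  have ends: "a \<in> L1" "b \<in> L1" "a \<in> L2" "b \<in> L2" "a \<in> L3" "b \<in> L3" using L link_ends by auto
  have notin: "b1 \<notin> L2" "b1 \<notin> L3" "b2 \<notin> L1" "b2 \<notin> L3" "b3 \<notin> L1" "b3 \<notin> L2" using bj I by blast+
  have l12: "simple_path (g1 +++ reversepath g2)" "pathfinish (g1 +++ reversepath g2) = pathstart (g1 +++ reversepath g2)"
    "path_image (g1 +++ reversepath g2) = L1 \<union> L2" using theta_loop[of g1 g2] g I' im by auto
  have l13: "simple_path (g1 +++ reversepath g3)" "pathfinish (g1 +++ reversepath g3) = pathstart (g1 +++ reversepath g3)"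
    "path_image (g1 +++ reversepath g3) = L1 \<union> L3" using theta_loop[of g1 g3] g I' im by auto
  have l23: "simple_path (g2 +++ reversepath g3)" "pathfinish (g2 +++ reversepath g3) = pathstart (g2 +++ reversepath g3)"
    "path_image (g2 +++ reversepath g3) = L2 \<union> L3" using theta_loop[of g2 g3] g I' im by auto
  have n12: "\<not> (w \<in> inside (L1 \<union> L2) \<and> w \<in> inside (L2 \<union> L3))"
    using theta_two_inside[OF l12, of L3 a b b1] s1 s3 bj ends notin bd[OF L(2,3)] by blast
  have n13: "\<not> (w \<in> inside (L1 \<union> L3) \<and> w \<in> inside (L2 \<union> L3))"
    using theta_two_inside[OF l13, of L2 a b b1] s1 s2 bj ends notin bd[OF L(2,3)] by (auto simp: Un_commute)
  have n21: "\<not> (w \<in> inside (L1 \<union> L2) \<and> w \<in> inside (L1 \<union> L3))"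
    using theta_two_inside[OF l12(1,2), of L2 L1 L3 a b b2] l12(3) s2 s3 bj ends notin bd[OF L(1,3)]
    by (auto simp: Un_commute)
  have wind3: "z \<notin> inside (L1 \<union> L2)"
    if "z \<notin> L1 \<union> L2 \<union> L3" "z \<notin> inside (L1 \<union> L3)" "z \<notin> inside (L2 \<union> L3)" for z
    using theta_winding[of g1 g2 g3 a b z] g I' im that by simp
  have wind2: "z \<notin> inside (L1 \<union> L3)"
    if "z \<notin> L1 \<union> L2 \<union> L3" "z \<notin> inside (L1 \<union> L2)" "z \<notin> inside (L2 \<union> L3)" for z
    using theta_winding[of g1 g3 g2 a b z] g I' im that by (auto simp: Un_ac Int_commute)
  have wind1: "z \<notin> inside (L2 \<union> L3)"
    if "z \<notin> L1 \<union> L2 \<union> L3" "z \<notin> inside (L1 \<union> L2)" "z \<notin> inside (L1 \<union> L3)" for z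
    using theta_winding[of g2 g3 g1 a b z] g I' im that by (auto simp: Un_ac Int_commute)
  \<comment> \<open>At most one of the loops has \<open>w\<close> inside by \<open>n12\<close>,
    \<open>n13\<close>, \<open>n21\<close>; exactly one is impossible by winding numbers. So none
    has, and the other point \<open>p\<close> obtained next is inside exactly one.\<close>
  have out: "w \<notin> inside (L1 \<union> L2)" "w \<notin> inside (L1 \<union> L3)" "w \<notin> inside (L2 \<union> L3)"
    using n12 n13 n21 wind1[OF wn] wind2[OF wn] wind3[OF wn] by blast+
  obtain p where "p \<in> inside (L1 \<union> L2)" "p \<notin> L1 \<union> L2 \<union> L3" "p \<notin> inside (L2 \<union> L3)" "p \<notin> inside (L1 \<union> L3)"
    by (rule theta_all_outside[OF l12, of L3 a b b1 b2]) (use s1 s2 s3 out bj ends notin in auto)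
  then show False using wind3[of p] by blast
qed

section \<open>Tripods: subdivided stars with three legs\<close>

definition tripod :: "complex \<Rightarrow> complex \<Rightarrow> complex \<Rightarrow> complex \<Rightarrow> complex set \<Rightarrow> bool" where
  "tripod c b1 b2 b3 T \<longleftrightarrow> (\<exists>P1 P2 P3. link c b1 P1 \<and> link c b2 P2 \<and> link c b3 P3 \<and>
     P1 \<inter> P2 = {c} \<and> P1 \<inter> P3 = {c} \<and> P2 \<inter> P3 = {c} \<and> T = P1 \<union> P2 \<union> P3)"

lemma tripodE:
  assumes "tripod c b1 b2 b3 T"
  obtains P1 P2 P3 where "link c b1 P1" "link c b2 P2" "link c b3 P3"
    "P1 \<inter> P2 = {c}" "P1 \<inter> P3 = {c}" "P2 \<inter> P3 = {c}" "T = P1 \<union> P2 \<union> P3"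
    "c \<noteq> b1" "c \<noteq> b2" "c \<noteq> b3" "{c, b1} \<subseteq> P1" "{c, b2} \<subseteq> P2" "{c, b3} \<subseteq> P3"
    "b2 \<notin> P1" "b3 \<notin> P1" "b1 \<notin> P2" "b3 \<notin> P2" "b1 \<notin> P3" "b2 \<notin> P3"
proof -
  obtain P1 P2 P3 where P: "link c b1 P1" "link c b2 P2" "link c b3 P3"
    "P1 \<inter> P2 = {c}" "P1 \<inter> P3 = {c}" "P2 \<inter> P3 = {c}" "T = P1 \<union> P2 \<union> P3"
    using assms unfolding tripod_def by metis
  moreover note P(1-3)[THEN link_neq]
  moreover have "{c, b1} \<subseteq> P1" "{c, b2} \<subseteq> P2" "{c, b3} \<subseteq> P3" using P(1-3)[THEN link_ends] by auto
  moreover from calculation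
  have "b2 \<notin> P1" "b3 \<notin> P1" "b1 \<notin> P2" "b3 \<notin> P2" "b1 \<notin> P3" "b2 \<notin> P3"
    by (auto simp: set_eq_iff)
  ultimately show thesis using that by blast
qed

lemma tripods_K33:
  assumes "tripod a1 b1 b2 b3 T1" "tripod a2 b1 b2 b3 T2" "tripod a3 b1 b2 b3 T3"
    and T: "T1 \<inter> T2 \<subseteq> {b1, b2, b3}" "T1 \<inter> T3 \<subseteq> {b1, b2, b3}" "T2 \<inter> T3 \<subseteq> {b1, b2, b3}"
  shows False
proof -
  obtain P1 P2 P3 where P: "link a1 b1 P1" "link a1 b2 P2" "link a1 b3 P3"
    "P1 \<inter> P2 = {a1}" "P1 \<inter> P3 = {a1}" "P2 \<inter> P3 = {a1}" "T1 = P1 \<union> P2 \<union> P3"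
    and nP: "a1 \<noteq> b1" "a1 \<noteq> b2" "a1 \<noteq> b3"
    and eP: "{a1, b1} \<subseteq> P1" "{a1, b2} \<subseteq> P2" "{a1, b3} \<subseteq> P3"
    and farP: "b2 \<notin> P1" "b3 \<notin> P1" "b1 \<notin> P2" "b3 \<notin> P2" "b1 \<notin> P3" "b2 \<notin> P3"
    using assms(1) by (rule tripodE)
  obtain Q1 Q2 Q3 where Q: "link a2 b1 Q1" "link a2 b2 Q2" "link a2 b3 Q3"
    "Q1 \<inter> Q2 = {a2}" "Q1 \<inter> Q3 = {a2}" "Q2 \<inter> Q3 = {a2}" "T2 = Q1 \<union> Q2 \<union> Q3"
    and nQ: "a2 \<noteq> b1" "a2 \<noteq> b2" "a2 \<noteq> b3"
    and eQ: "{a2, b1} \<subseteq> Q1" "{a2, b2} \<subseteq> Q2" "{a2, b3} \<subseteq> Q3"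
    and farQ: "b2 \<notin> Q1" "b3 \<notin> Q1" "b1 \<notin> Q2" "b3 \<notin> Q2" "b1 \<notin> Q3" "b2 \<notin> Q3"
    using assms(2) by (rule tripodE)
  obtain R1 R2 R3 where R: "link a3 b1 R1" "link a3 b2 R2" "link a3 b3 R3"
    "R1 \<inter> R2 = {a3}" "R1 \<inter> R3 = {a3}" "R2 \<inter> R3 = {a3}" "T3 = R1 \<union> R2 \<union> R3"
    and nR: "a3 \<noteq> b1" "a3 \<noteq> b2" "a3 \<noteq> b3"
    and eR: "{a3, b1} \<subseteq> R1" "{a3, b2} \<subseteq> R2" "{a3, b3} \<subseteq> R3"
    and farR: "b2 \<notin> R1" "b3 \<notin> R1" "b1 \<notin> R2" "b3 \<notin> R2" "b1 \<notin> R3" "b2 \<notin> R3"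
    using assms(3) by (rule tripodE)
  have common: "X \<inter> Y = S" if "X \<subseteq> T" "Y \<subseteq> T'" "T \<inter> T' \<subseteq> {b1, b2, b3}" "S \<subseteq> X \<inter> Y"
    "\<And>b. b \<in> {b1, b2, b3} \<Longrightarrow> b \<in> X \<Longrightarrow> b \<in> Y \<Longrightarrow> b \<in> S" for X Y T T' S
    using that by blast
  have PQ: "P1 \<inter> Q1 = {b1}" "P2 \<inter> Q2 = {b2}" "P3 \<inter> Q3 = {b3}"
    "P1 \<inter> Q2 = {}" "P1 \<inter> Q3 = {}" "P2 \<inter> Q1 = {}" "P2 \<inter> Q3 = {}" "P3 \<inter> Q1 = {}" "P3 \<inter> Q2 = {}"
    by (rule common[OF _ _ T(1)]; use P(7) Q(7) eP eQ farP farQ in auto)+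
  let ?L1 = "P1 \<union> Q1" and ?L2 = "P2 \<union> Q2" and ?L3 = "P3 \<union> Q3"
  \<comment> \<open>The feet are removed because they lie on the theta curve through
    \<open>a1\<close> and \<open>a2\<close>; each remains a limit point of its leg.\<close>
  let ?W = "(R1 - {b1}) \<union> (R2 - {b2}) \<union> (R3 - {b3})"
  have L: "link a1 a2 ?L1" "link a1 a2 ?L2" "link a1 a2 ?L3"
    using P Q PQ by (auto intro: link_join link_sym)
  have I: "?L1 \<inter> ?L2 = {a1, a2}" "?L1 \<inter> ?L3 = {a1, a2}" "?L2 \<inter> ?L3 = {a1, a2}"
    using P(4-6) Q(4-6) PQ by (simp_all add: Int_Un_distrib Int_Un_distrib2 insert_commute Int_commute)
  have "a3 \<in> R1 - {b1}" "a3 \<in> R2 - {b2}" "a3 \<in> R3 - {b3}" using eR nR by auto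
  then have "topological_space_class.connected ?W"
    using R(1-3)[THEN link_minus_end(1)] by (intro connected_Un) auto
  moreover have "?W \<inter> {b1, b2, b3} = {}" using farR by auto
  then have "?W \<inter> (?L1 \<union> ?L2 \<union> ?L3) = {}" using T(2,3) P(7) Q(7) R(7) by blast
  moreover have "b1 \<in> closure ?W" "b2 \<in> closure ?W" "b3 \<in> closure ?W"
    using R(1-3)[THEN link_minus_end(2)] by (simp_all add: closure_Un)
  moreover have "b1 \<in> ?L1 - {a1, a2}" "b2 \<in> ?L2 - {a1, a2}" "b3 \<in> ?L3 - {a1, a2}"
    using eP nP nQ by auto
  ultimately show False using theta_faces[OF L I] by blast
qed

lemma tripod_swap:
  assumes "tripod c b1 b2 b3 T"
  shows "tripod c b2 b1 b3 T" "tripod c b1 b3 b2 T"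
proof -
  obtain P1 P2 P3 where P: "link c b1 P1" "link c b2 P2" "link c b3 P3"
    "P1 \<inter> P2 = {c}" "P1 \<inter> P3 = {c}" "P2 \<inter> P3 = {c}" "T = P1 \<union> P2 \<union> P3"
    using assms unfolding tripod_def by metis
  show "tripod c b2 b1 b3 T" unfolding tripod_def
    by (rule exI[of _ P2], rule exI[of _ P1], rule exI[of _ P3]) (use P in auto)
  show "tripod c b1 b3 b2 T" unfolding tripod_def
    by (rule exI[of _ P1], rule exI[of _ P3], rule exI[of _ P2]) (use P in auto)
qed

text \<open>Lengthens one leg beyond its foot, which yields subdivisions of K33: a centre may reach
  a foot through an intermediate vertex.\<close>

lemma tripod_extend:
  assumes "tripod c b1 b2 b3 T" "link b1 b Q" "T \<inter> Q = {b1}"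
  shows "tripod c b b2 b3 (T \<union> Q)"
proof -
  obtain P1 P2 P3 where P: "link c b1 P1" "link c b2 P2" "link c b3 P3"
    "P1 \<inter> P2 = {c}" "P1 \<inter> P3 = {c}" "P2 \<inter> P3 = {c}" "T = P1 \<union> P2 \<union> P3" and e: "{c, b1} \<subseteq> P1"
    and far: "b1 \<notin> P2" "b1 \<notin> P3"
    using assms(1) by (rule tripodE)
  have "P1 \<inter> Q = {b1}" "P2 \<inter> Q = {}" "P3 \<inter> Q = {}" using assms(3) P(7) e far by auto
  then show ?thesis unfolding tripod_def
    using P link_join[OF P(1) assms(2)]
    by (intro exI[of _ "P1 \<union> Q"] exI[of _ P2] exI[of _ P3]) (auto simp: Int_Un_distrib Int_Un_distrib2 Int_commute)
qed

section \<open>Crossings in 1-planar drawings\<close>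

text \<open>
  \<open>cr e f\<close> says that two edges without common end meet outside the vertices. It does not
  distinguish crossing from touching; the arguments only use that the common point is unique.
\<close>

locale one_plane =
  fixes V :: "'a set" and Ed :: "'a set set" and pos :: "'a \<Rightarrow> complex"
    and E :: "'a set \<Rightarrow> complex set" and cr :: "'a set \<Rightarrow> 'a set \<Rightarrow> bool"
  assumes inj: "inj_on pos V"
    and edge_verts: "e \<in> Ed \<Longrightarrow> e \<subseteq> V"
    and edge_doubleton: "e \<in> Ed \<Longrightarrow> \<exists>u v. e = {u, v}"
    and edge_link: "{u, v} \<in> Ed \<Longrightarrow> link (pos u) (pos v) (E {u, v})"
    and edge_pos: "e \<in> Ed \<Longrightarrow> E e \<inter> pos ` V = pos ` e"
    and cr_edges: "cr e f \<Longrightarrow> e \<in> Ed \<and> f \<in> Ed \<and> e \<inter> f = {}"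
    and cr_sym: "cr e f \<Longrightarrow> cr f e"
    and cr_unique: "cr e f \<Longrightarrow> cr e g \<Longrightarrow> f = g"
    and cr_point: "cr e f \<Longrightarrow> \<exists>x. E e \<inter> E f = {x} \<and> x \<notin> pos ` V"
    and no_cr: "e \<in> Ed \<Longrightarrow> f \<in> Ed \<Longrightarrow> e \<noteq> f \<Longrightarrow> \<not> cr e f \<Longrightarrow> E e \<inter> E f \<subseteq> pos ` (e \<inter> f)"
begin

text \<open>
  The centre of the tripod is either a vertex or a crossing; in the second case the tripod covers
  one of its two edges only up to the crossing, which is why \<open>U\<close> is not determined by \<open>F\<close>.
\<close>

definition tri :: "'a set set \<Rightarrow> 'a set \<Rightarrow> 'a \<Rightarrow> 'a \<Rightarrow> 'a \<Rightarrow> bool" where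
  "tri F U s1 s2 s3 \<longleftrightarrow> F \<subseteq> Ed \<and> U \<subseteq> V \<and>
     (\<exists>c T. tripod c (pos s1) (pos s2) (pos s3) T \<and> T \<subseteq> \<Union> (E ` F) \<and> T \<inter> pos ` V \<subseteq> pos ` U)"

lemma tri_swap:
  assumes "tri F U s1 s2 s3"
  shows "tri F U s2 s1 s3" "tri F U s1 s3 s2"
  using assms tripod_swap unfolding tri_def by meson+

lemma edge_neq: "{u, v} \<in> Ed \<Longrightarrow> u \<noteq> v"
  using link_neq[OF edge_link] by auto

text \<open>Turns the topological statement into bookkeeping with finite sets. A common point of two
  tripods lies on two different edges; if these do not cross, it is a common end, hence a vertex in
  both sets \<open>U\<close>, hence a foot.\<close>

lemma tri_K33:
  assumes t: "tri F1 U1 s1 s2 s3" "tri F2 U2 s1 s2 s3" "tri F3 U3 s1 s2 s3"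
    and F: "F1 \<inter> F2 = {}" "F1 \<inter> F3 = {}" "F2 \<inter> F3 = {}"
    and U: "U1 \<inter> U2 \<subseteq> {s1, s2, s3}" "U1 \<inter> U3 \<subseteq> {s1, s2, s3}" "U2 \<inter> U3 \<subseteq> {s1, s2, s3}"
  obtains e f where "cr e f" "e \<in> F1 \<and> f \<in> F2 \<or> e \<in> F1 \<and> f \<in> F3 \<or> e \<in> F2 \<and> f \<in> F3"
proof (rule ccontr)
  assume "\<not> thesis"
  then have c: "\<forall>e\<in>F1. \<forall>f\<in>F2. \<not> cr e f" "\<forall>e\<in>F1. \<forall>f\<in>F3. \<not> cr e f" "\<forall>e\<in>F2. \<forall>f\<in>F3. \<not> cr e f"
    using that by blast+
  have meet: "T \<inter> T' \<subseteq> pos ` {s1, s2, s3}"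
    if m: "T \<subseteq> \<Union> (E ` F)" "T \<inter> pos ` V \<subseteq> pos ` U" "T' \<subseteq> \<Union> (E ` F')" "T' \<inter> pos ` V \<subseteq> pos ` U'"
      "F \<subseteq> Ed" "F' \<subseteq> Ed" "U \<subseteq> V" "U' \<subseteq> V" "F \<inter> F' = {}" "U \<inter> U' \<subseteq> {s1, s2, s3}" "\<forall>e\<in>F. \<forall>f\<in>F'. \<not> cr e f"
    for T T' F F' U U'
  proof
    fix p assume p: "p \<in> T \<inter> T'"
    then have "p \<in> \<Union> (E ` F)" "p \<in> \<Union> (E ` F')" using m(1,3) by auto
    then obtain e f where ef: "e \<in> F" "f \<in> F'" "p \<in> E e" "p \<in> E f" by blast
    then have "E e \<inter> E f \<subseteq> pos ` (e \<inter> f)" using m(5,6,9,11) by (intro no_cr) auto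
    then obtain u where u: "u \<in> e" "p = pos u" using ef by blast
    then have V: "u \<in> V" using ef(1) m(5) edge_verts by blast
    have "pos u \<in> pos ` U" "pos u \<in> pos ` U'" using p u(2) V m(2,4) by blast+
    then have "u \<in> U" "u \<in> U'" using inj_on_image_mem_iff[OF inj V] m(7,8) by blast+
    then show "p \<in> pos ` {s1, s2, s3}" using u m(10) by blast
  qed
  obtain c1 T1 where 1: "tripod c1 (pos s1) (pos s2) (pos s3) T1" "T1 \<subseteq> \<Union> (E ` F1)" "T1 \<inter> pos ` V \<subseteq> pos ` U1"
    "F1 \<subseteq> Ed" "U1 \<subseteq> V" using t(1) unfolding tri_def by auto
  obtain c2 T2 where 2: "tripod c2 (pos s1) (pos s2) (pos s3) T2" "T2 \<subseteq> \<Union> (E ` F2)" "T2 \<inter> pos ` V \<subseteq> pos ` U2"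
    "F2 \<subseteq> Ed" "U2 \<subseteq> V" using t(2) unfolding tri_def by auto
  obtain c3 T3 where 3: "tripod c3 (pos s1) (pos s2) (pos s3) T3" "T3 \<subseteq> \<Union> (E ` F3)" "T3 \<inter> pos ` V \<subseteq> pos ` U3"
    "F3 \<subseteq> Ed" "U3 \<subseteq> V" using t(3) unfolding tri_def by auto
  show False
    using tripods_K33[OF 1(1) 2(1) 3(1)]
      meet[OF 1(2,3) 2(2,3) 1(4) 2(4) 1(5) 2(5) F(1) U(1) c(1)]
      meet[OF 1(2,3) 3(2,3) 1(4) 3(4) 1(5) 3(5) F(2) U(2) c(2)]
      meet[OF 2(2,3) 3(2,3) 2(4) 3(4) 2(5) 3(5) F(3) U(3) c(3)] by simp
qed

lemma tri_vertex:
  assumes "{v, s1} \<in> Ed" "{v, s2} \<in> Ed" "{v, s3} \<in> Ed" "s1 \<noteq> s2" "s1 \<noteq> s3" "s2 \<noteq> s3"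
  shows "tri {{v, s1}, {v, s2}, {v, s3}} {v, s1, s2, s3} s1 s2 s3"
proof -
  have I: "E {v, s} \<inter> E {v, t} = {pos v}" if "{v, s} \<in> Ed" "{v, t} \<in> Ed" "s \<noteq> t" for s t
  proof -
    have "\<not> cr {v, s} {v, t}" using cr_edges by blast
    then have "E {v, s} \<inter> E {v, t} \<subseteq> pos ` ({v, s} \<inter> {v, t})"
      using that by (intro no_cr) (auto simp: doubleton_eq_iff)
    moreover have "{v, s} \<inter> {v, t} = {v}" using that edge_neq by auto
    ultimately show ?thesis using link_ends[OF edge_link] that by auto
  qed
  have "tripod (pos v) (pos s1) (pos s2) (pos s3) (E {v, s1} \<union> E {v, s2} \<union> E {v, s3})"
    unfolding tripod_def using assms I edge_link
    by (intro exI[of _ "E {v, s1}"] exI[of _ "E {v, s2}"] exI[of _ "E {v, s3}"]) auto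
  moreover have "{v, s1, s2, s3} \<subseteq> V" using assms edge_verts by blast
  moreover have "(E {v, s1} \<union> E {v, s2} \<union> E {v, s3}) \<inter> pos ` V \<subseteq> pos ` {v, s1, s2, s3}"
    using assms(1-3)[THEN edge_pos] by auto
  ultimately show ?thesis unfolding tri_def using assms(1-3)
    by (intro conjI exI[of _ "pos v"] exI[of _ "E {v, s1} \<union> E {v, s2} \<union> E {v, s3}"]) auto
qed

text \<open>The half of \<open>{c, d}\<close> between the crossing and \<open>d\<close> is dropped.
  So \<open>d\<close> is not on the tripod, although its edge belongs to \<open>F\<close>, and may
  lie on another tripod of the same K33.\<close>

lemma tri_crossing3:
  assumes "cr {a, b} {c, d}"
  shows "tri {{a, b}, {c, d}} {a, b, c} a b c"
proof -
  have e: "{a, b} \<in> Ed" "{c, d} \<in> Ed" using cr_edges[OF assms] by auto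
  obtain x where x: "E {a, b} \<inter> E {c, d} = {x}" "x \<notin> pos ` V" using cr_point[OF assms] by auto
  have V: "a \<in> V" "b \<in> V" "c \<in> V" "d \<in> V" using e edge_verts by auto
  then have xn: "x \<noteq> pos a" "x \<noteq> pos b" "x \<noteq> pos c" "x \<noteq> pos d" using x by auto
  obtain A B where AB: "link (pos a) x A" "link x (pos b) B" "A \<union> B = E {a, b}" "A \<inter> B = {x}"
    using link_split[OF edge_link[OF e(1)], of x] x xn by auto
  obtain C D where CD: "link (pos c) x C" "link x (pos d) D" "C \<union> D = E {c, d}" "C \<inter> D = {x}"
    using link_split[OF edge_link[OF e(2)], of x] x xn by auto
  have xin: "x \<in> A" "x \<in> B" "x \<in> C" using AB CD link_ends by auto
  have "A \<inter> C = {x}" "B \<inter> C = {x}" using AB(3) CD(3) x(1) xin by blast+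
  have "tripod x (pos a) (pos b) (pos c) (A \<union> B \<union> C)"
    unfolding tripod_def using AB(2,4) link_sym[OF AB(1)] link_sym[OF CD(1)]
      \<open>A \<inter> C = {x}\<close> \<open>B \<inter> C = {x}\<close>
    by blast
  moreover have "A \<union> B \<union> C \<subseteq> \<Union> (E ` {{a, b}, {c, d}})" using AB CD by auto
  moreover have "pos d \<notin> C" using CD(2,4) xn link_ends by (metis IntI singletonD)
  then have "C \<inter> pos ` V \<subseteq> {pos c}" using edge_pos[OF e(2)] CD(3) by auto
  then have "(A \<union> B \<union> C) \<inter> pos ` V \<subseteq> pos ` {a, b, c}"
    using edge_pos[OF e(1)] AB(3) by auto
  ultimately show ?thesis unfolding tri_def using e V by blast
qed

lemma tri_crossing:
  assumes "cr {a, b} {c, d}" and s: "s1 \<in> {a, b, c, d}" "s2 \<in> {a, b, c, d}" "s3 \<in> {a, b, c, d}"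
    "s1 \<noteq> s2" "s1 \<noteq> s3" "s2 \<noteq> s3"
  shows "tri {{a, b}, {c, d}} {s1, s2, s3} s1 s2 s3"
proof -
  let ?P = "\<lambda>s1 s2 s3. tri {{a, b}, {c, d}} {s1, s2, s3} s1 s2 s3"
  have perm: "?P s1 s2 s3 \<and> ?P s1 s3 s2 \<and> ?P s2 s1 s3 \<and> ?P s2 s3 s1 \<and> ?P s3 s1 s2 \<and> ?P s3 s2 s1"
    if "?P s1 s2 s3" for s1 s2 s3
  proof -
    have eq: "{s1, s3, s2} = {s1, s2, s3}" "{s2, s1, s3} = {s1, s2, s3}" "{s2, s3, s1} = {s1, s2, s3}"
      "{s3, s1, s2} = {s1, s2, s3}" "{s3, s2, s1} = {s1, s2, s3}" by auto
    show ?thesis unfolding eq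
      using that tri_swap[OF that] tri_swap[OF tri_swap(1)[OF that]] tri_swap[OF tri_swap(2)[OF that]]
        tri_swap(1)[OF tri_swap(2)[OF tri_swap(1)[OF that]]] by blast
  qed
  \<comment> \<open>These triples omit \<open>d\<close>, \<open>c\<close>, \<open>b\<close>,
    \<open>a\<close> in turn; \<open>perm\<close> supplies all orders.\<close>
  have "?P a b c" "?P a b d" "?P c d a" "?P c d b"
    using tri_crossing3[of a b c d] tri_crossing3[of a b d c] tri_crossing3[of c d a b] tri_crossing3[of c d b a]
      assms(1) cr_sym[OF assms(1)] by (simp_all add: insert_commute)
  from this[THEN perm] show ?thesis using s
    by simp (elim disjE; simp)
qed

lemma tri_extend:
  assumes "tri F U s1 s2 s3" "{s1, t} \<in> Ed" "{s1, t} \<notin> F" "t \<notin> U" "\<And>f. f \<in> F \<Longrightarrow> \<not> cr {s1, t} f"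
  shows "tri (insert {s1, t} F) (insert t U) t s2 s3"
proof -
  obtain c T where T: "tripod c (pos s1) (pos s2) (pos s3) T" "T \<subseteq> \<Union> (E ` F)" "T \<inter> pos ` V \<subseteq> pos ` U"
    and F: "F \<subseteq> Ed" "U \<subseteq> V" using assms(1) unfolding tri_def by auto
  have V: "s1 \<in> V" "t \<in> V" using assms(2) edge_verts by auto
  have "T \<inter> E {s1, t} \<subseteq> {pos s1}"
  proof
    fix p assume p: "p \<in> T \<inter> E {s1, t}"
    then obtain f where f: "f \<in> F" "p \<in> E f" using T by blast
    then have "E {s1, t} \<inter> E f \<subseteq> pos ` ({s1, t} \<inter> f)" using assms F by (intro no_cr) auto
    then have "p = pos s1 \<or> p = pos t" using p f by blast
    moreover have "pos t \<notin> T"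
    proof
      assume "pos t \<in> T"
      then obtain u where "u \<in> U" "pos t = pos u" using T(3) V by blast
      then show False using assms(4) inj V F by (auto dest: inj_onD)
    qed
    ultimately show "p \<in> {pos s1}" using p by auto
  qed
  moreover have "pos s1 \<in> T \<inter> E {s1, t}"
    using T(1) link_ends[OF edge_link[OF assms(2)]] by (auto elim: tripodE)
  ultimately have "T \<inter> E {s1, t} = {pos s1}" by blast
  note ext = tripod_extend[OF T(1) edge_link[OF assms(2)] this]
  have "(T \<union> E {s1, t}) \<inter> pos ` V \<subseteq> pos ` insert t U"
  proof -
    have "pos s1 \<in> pos ` U" using T(1,3) V by (auto elim!: tripodE)
    moreover have "(T \<union> E {s1, t}) \<inter> pos ` V \<subseteq> pos ` U \<union> {pos s1, pos t}"
      using T(3) edge_pos[OF assms(2)] by blast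
    ultimately show ?thesis by auto
  qed
  moreover have "T \<union> E {s1, t} \<subseteq> \<Union> (E ` insert {s1, t} F)" using T(2) by auto
  ultimately show ?thesis unfolding tri_def using ext F V assms(2) by blast
qed

lemma tri_crossing_edges:
  assumes "cr e f" "{s1, s2, s3} \<subseteq> e \<union> f" "s1 \<noteq> s2" "s1 \<noteq> s3" "s2 \<noteq> s3"
  shows "tri {e, f} {s1, s2, s3} s1 s2 s3"
proof -
  obtain a b c d where ef: "e = {a, b}" "f = {c, d}"
    using cr_edges[OF assms(1)] edge_doubleton by metis
  have "s1 \<in> {a, b, c, d}" "s2 \<in> {a, b, c, d}" "s3 \<in> {a, b, c, d}" using assms(2) ef by auto
  then show ?thesis using tri_crossing[of a b c d s1 s2 s3] assms(1,3-) unfolding ef by blast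
qed

section \<open>Crossings as a matching of the edges\<close>

lemma cr_pairs_eq:
  assumes "cr e f" "cr g h" "{e, f} \<inter> {g, h} \<noteq> {}"
  shows "{e, f} = {g, h}"
proof -
  consider "g = e" | "g = f" | "h = e" | "h = f" using assms(3) by blast
  then show ?thesis
  proof cases
    case 1
    then have "f = h" using assms by (intro cr_unique[of e f h]) simp_all
    then show ?thesis using 1 by blast
  next
    case 2
    then have "e = h" using assms by (intro cr_unique[of f e h]) (simp_all add: cr_sym)
    then show ?thesis using 2 by blast
  next
    case 3
    then have "f = g" using assms by (intro cr_unique[of e f g]) (simp_all add: cr_sym)
    then show ?thesis using 3 by blast
  next
    case 4
    then have "e = g" using assms by (intro cr_unique[of f e g]) (simp_all add: cr_sym)
    then show ?thesis using 4 by blast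
  qed
qed

text \<open>Two edges that cross have spent their only crossings on each other. This makes a tripod
  centred at a crossing safe from every other edge.\<close>

lemma cr_pair_closed:
  assumes "cr e f" "g \<in> {e, f}" "cr g h \<or> cr h g"
  shows "h \<in> {e, f}"
proof -
  have "cr g h" using assms(3) cr_sym by blast
  then have "{e, f} = {g, h}" using assms(1,2) cr_pairs_eq by blast
  then show ?thesis by blast
qed

abbreviation star :: "'a \<Rightarrow> 'a set \<Rightarrow> 'a set set" where
  "star v S \<equiv> (\<lambda>s. {v, s}) ` S"

lemma star_Int_star: "u \<noteq> v \<Longrightarrow> u \<notin> S \<Longrightarrow> star u S \<inter> star v S = {}"
  by (auto simp: doubleton_eq_iff)

lemma tri_star:
  assumes "star v {s1, s2, s3} \<subseteq> Ed" "s1 \<noteq> s2" "s1 \<noteq> s3" "s2 \<noteq> s3"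
  shows "tri (star v {s1, s2, s3}) {v, s1, s2, s3} s1 s2 s3"
  using tri_vertex[of v s1 s2 s3] assms by simp

lemma tri_K33_False:
  assumes "tri F1 U1 s1 s2 s3" "tri F2 U2 s1 s2 s3" "tri F3 U3 s1 s2 s3"
    "F1 \<inter> F2 = {}" "F1 \<inter> F3 = {}" "F2 \<inter> F3 = {}"
    "U1 \<inter> U2 \<subseteq> {s1, s2, s3}" "U1 \<inter> U3 \<subseteq> {s1, s2, s3}" "U2 \<inter> U3 \<subseteq> {s1, s2, s3}"
    "\<And>e f. e \<in> F1 \<Longrightarrow> f \<in> F2 \<Longrightarrow> \<not> cr e f" "\<And>e f. e \<in> F1 \<Longrightarrow> f \<in> F3 \<Longrightarrow> \<not> cr e f"
    "\<And>e f. e \<in> F2 \<Longrightarrow> f \<in> F3 \<Longrightarrow> \<not> cr e f"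
  shows False
proof (rule tri_K33[OF assms(1-9)])
  fix e f
  assume "cr e f" "e \<in> F1 \<and> f \<in> F2 \<or> e \<in> F1 \<and> f \<in> F3 \<or> e \<in> F2 \<and> f \<in> F3"
  then show False using assms(10)[of e f] assms(11)[of e f] assms(12)[of e f] by blast
qed

lemma K33_crossing:
  assumes d: "distinct [a1, a2, a3, b1, b2, b3]"
    and Ed: "\<And>a b. a \<in> {a1, a2, a3} \<Longrightarrow> b \<in> {b1, b2, b3} \<Longrightarrow> {a, b} \<in> Ed"
  obtains a a' b b' where "a \<in> {a1, a2, a3}" "a' \<in> {a1, a2, a3}" "b \<in> {b1, b2, b3}" "b' \<in> {b1, b2, b3}"
    "a \<noteq> a'" "b \<noteq> b'" "cr {a, b} {a', b'}"
proof (rule ccontr)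
  assume *: "\<not> thesis"
  note goal = that
  let ?B = "{b1, b2, b3}"
  have t: "tri (star a ?B) {a, b1, b2, b3} b1 b2 b3" if "a \<in> {a1, a2, a3}" for a
    using Ed[OF that] d by (intro tri_star) auto
  have no: "\<not> cr e f" if a: "a \<in> {a1, a2, a3}" "a' \<in> {a1, a2, a3}" "a \<noteq> a'" and e: "e \<in> star a ?B" "f \<in> star a' ?B"
    for a a' e f
  proof
    assume cr: "cr e f"
    from e obtain b b' where b: "b \<in> ?B" "b' \<in> ?B" "e = {a, b}" "f = {a', b'}" by blast
    then have "b \<noteq> b'" using cr_edges[OF cr] by blast
    then show False using * goal[OF a(1,2) b(1,2) a(3)] cr b by blast
  qed
  have n: "a1 \<noteq> a2" "a1 \<noteq> a3" "a2 \<noteq> a3" "a1 \<notin> ?B" "a2 \<notin> ?B" "a3 \<notin> ?B" using d by auto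
  show False
  proof (rule tri_K33_False[OF t[of a1] t[of a2] t[of a3]])
    show "star a1 ?B \<inter> star a2 ?B = {}" "star a1 ?B \<inter> star a3 ?B = {}" "star a2 ?B \<inter> star a3 ?B = {}"
      using n by (intro star_Int_star; blast)+
    show "{a1, b1, b2, b3} \<inter> {a2, b1, b2, b3} \<subseteq> {b1, b2, b3}" "{a1, b1, b2, b3} \<inter> {a3, b1, b2, b3} \<subseteq> {b1, b2, b3}"
      "{a2, b1, b2, b3} \<inter> {a3, b1, b2, b3} \<subseteq> {b1, b2, b3}" using n by blast+
  qed (use n no[of a1 a2] no[of a1 a3] no[of a2 a3] in simp_all)
qed

text \<open>The crossing of \<open>e\<close> and \<open>f\<close> serves as the third centre of a
  K33 besides \<open>u\<close> and \<open>v\<close>. Its own edges admit no further crossing, so the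
  conflict must occur between the stars of \<open>u\<close> and \<open>v\<close>. This is the device
  that forces new crossings.\<close>

lemma crossing_star:
  assumes cr: "cr e f" and s: "{s1, s2, s3} \<subseteq> e \<union> f" "s1 \<noteq> s2" "s1 \<noteq> s3" "s2 \<noteq> s3"
    and uv: "u \<notin> e \<union> f" "v \<notin> e \<union> f" "u \<noteq> v"
    and Ed: "star u {s1, s2, s3} \<subseteq> Ed" "star v {s1, s2, s3} \<subseteq> Ed"
  obtains s t where "s \<in> {s1, s2, s3}" "t \<in> {s1, s2, s3}" "s \<noteq> t" "cr {u, s} {v, t}"
proof (rule ccontr)
  assume *: "\<not> thesis"
  note goal = that
  let ?S = "{s1, s2, s3}"
  have ne: "u \<notin> ?S" "v \<notin> ?S" using uv s by auto
  note t = tri_star[OF Ed(1) s(2-4)] tri_star[OF Ed(2) s(2-4)]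
  have F: "{e, f} \<inter> star x ?S = {}" if "x \<in> {u, v}" for x using that uv by auto
  have no: "\<not> cr g h" if "g \<in> {e, f}" "h \<in> star x ?S" "x \<in> {u, v}" for g h x
    using that F[OF that(3)] cr_pair_closed[OF cr] by blast
  have no': "\<not> cr g h" if gh: "g \<in> star u ?S" "h \<in> star v ?S" for g h
  proof
    assume c: "cr g h"
    from gh obtain s t where st: "s \<in> ?S" "t \<in> ?S" "g = {u, s}" "h = {v, t}" by blast
    moreover from this have "s \<noteq> t" using cr_edges[OF c] by blast
    ultimately show False using * goal c by blast
  qed
  show False
    by (rule tri_K33_False[OF tri_crossing_edges[OF cr s] t])
      (use F[of u] F[of v] star_Int_star[OF uv(3) ne(1)] ne uv(3) no[where x = u] no[where x = v] no' in auto)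
qed

lemma crossing_edges_card:
  assumes "cr e f"
  shows "card (e \<union> f) = 4" "finite (e \<union> f)"
proof -
  obtain a b c d where ef: "e = {a, b}" "f = {c, d}"
    using cr_edges[OF assms(1)] edge_doubleton by metis
  moreover have "a \<noteq> b" "c \<noteq> d" using cr_edges[OF assms] edge_neq[of a b] edge_neq[of c d] ef by simp_all
  moreover have "e \<inter> f = {}" using cr_edges[OF assms] by simp
  ultimately show "card (e \<union> f) = 4" "finite (e \<union> f)" by auto
qed

text \<open>Two different crossings and \<open>x\<close> would be the centres of a K33 whose feet
  are three shared ends. The edges of both crossings are spent, and the star of \<open>x\<close> is
  edge-disjoint from them, so nothing could cross.\<close>

lemma two_crossings:
  assumes cr: "cr e f" "cr g h" and Q: "e \<union> f \<union> g \<union> h \<subseteq> Q" "finite Q" "card Q \<le> 5"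
    and x: "x \<notin> Q" "\<And>s. s \<in> (e \<union> f) \<inter> (g \<union> h) \<Longrightarrow> {x, s} \<in> Ed"
  shows "{e, f} = {g, h}"
proof (rule ccontr)
  assume ne: "{e, f} \<noteq> {g, h}"
  let ?I = "(e \<union> f) \<inter> (g \<union> h)"
  have F: "{e, f} \<inter> {g, h} = {}" using ne cr_pairs_eq[OF cr] by blast
  \<comment> \<open>Two sets of four ends within five vertices share at least 4 + 4 - 5 = 3.\<close>
  have "card ?I + card (e \<union> f \<union> (g \<union> h)) = 8"
    using card_Un_Int[of "e \<union> f" "g \<union> h"] crossing_edges_card[OF cr(1)] crossing_edges_card[OF cr(2)] by simp
  moreover have "card (e \<union> f \<union> (g \<union> h)) \<le> 5"
    using card_mono[OF Q(2), of "e \<union> f \<union> (g \<union> h)"] Q by auto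
  ultimately have "3 \<le> card ?I" by linarith
  then obtain S where S: "S \<subseteq> ?I" "card S = 3" by (meson obtain_subset_with_card_n)
  obtain s1 s2 s3 where s: "S = {s1, s2, s3}" "s1 \<noteq> s2" "s1 \<noteq> s3" "s2 \<noteq> s3"
    using S(2) by (auto simp: card_Suc_eq numeral_3_eq_3)
  have X: "{e, f} \<inter> star x {s1, s2, s3} = {}" "{g, h} \<inter> star x {s1, s2, s3} = {}" using x(1) Q(1) by auto
  have t1: "tri {e, f} {s1, s2, s3} s1 s2 s3" using S s cr by (intro tri_crossing_edges) auto
  have t2: "tri {g, h} {s1, s2, s3} s1 s2 s3" using S s cr by (intro tri_crossing_edges) auto
  have "star x {s1, s2, s3} \<subseteq> Ed" using x(2) S(1) s(1) by auto
  note t3 = tri_star[OF this s(2-4)]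
  have xS: "x \<notin> {s1, s2, s3}" using x(1) Q(1) S(1) s(1) by auto
  show False
  proof (rule tri_K33_False[OF t1 t2 t3 F X])
    show "\<not> cr e' f'" if "e' \<in> {e, f}" "f' \<in> {g, h}" for e' f'
      using that F cr_pair_closed[OF cr(1)] by blast
    show "\<not> cr e' f'" if "e' \<in> {e, f}" "f' \<in> star x {s1, s2, s3}" for e' f'
      using that X(1) cr_pair_closed[OF cr(1)] by blast
    show "\<not> cr e' f'" if "e' \<in> {g, h}" "f' \<in> star x {s1, s2, s3}" for e' f'
      using that X(2) cr_pair_closed[OF cr(2)] by blast
  qed (use xS in auto)
qed

section \<open>The complete graph on six vertices\<close>

text \<open>
  The uncrossed edges form the prism over the triangles \<open>a1 a2 a3\<close> and \<open>b1 b2 b3\<close>, with rungs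
  \<open>ai bi\<close>; each quadrangle spanned by two rungs contains one crossing.
\<close>

definition prism :: "'a \<Rightarrow> 'a \<Rightarrow> 'a \<Rightarrow> 'a \<Rightarrow> 'a \<Rightarrow> 'a \<Rightarrow> bool" where
  "prism a1 a2 a3 b1 b2 b3 \<longleftrightarrow> distinct [a1, a2, a3, b1, b2, b3] \<and>
     (\<forall>u \<in> {a1, a2, a3, b1, b2, b3}. \<forall>v \<in> {a1, a2, a3, b1, b2, b3}. u \<noteq> v \<longrightarrow> {u, v} \<in> Ed) \<and>
     cr {a1, b2} {a2, b1} \<and> cr {a1, b3} {a3, b1} \<and> cr {a2, b3} {a3, b2}"

definition K6 :: "'a set \<Rightarrow> bool" where
  "K6 K \<longleftrightarrow> card K = 6 \<and> (\<forall>u\<in>K. \<forall>v\<in>K. u \<noteq> v \<longrightarrow> {u, v} \<in> Ed)"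

lemma K6_edge: "K6 K \<Longrightarrow> u \<in> K \<Longrightarrow> v \<in> K \<Longrightarrow> u \<noteq> v \<Longrightarrow> {u, v} \<in> Ed"
  unfolding K6_def by blast

lemma doubleton_cases: "{x, y} = {z, w} \<Longrightarrow> x = z \<or> x = w"
  by blast

text \<open>The omitted vertex \<open>x\<close> is adjacent to all shared ends, so any five vertices
  of the K6 carry at most one crossing. Uniqueness arguments below look for a vertex that two
  crossings both avoid.\<close>

lemma K6_one_crossing:
  assumes "K6 K" "cr e f" "cr g h" "e \<union> f \<union> g \<union> h \<subseteq> K - {x}" "x \<in> K"
  shows "{e, f} = {g, h}"
proof (rule two_crossings[OF assms(2-4)])
  have "finite K" using assms(1) unfolding K6_def by (simp add: card_ge_0_finite)
  then show "finite (K - {x})" "card (K - {x}) \<le> 5" using assms(1,5) unfolding K6_def by auto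
  show "{x, s} \<in> Ed" if "s \<in> (e \<union> f) \<inter> (g \<union> h)" for s
  proof -
    have "s \<in> K - {x}" using that assms(4) by blast
    then show ?thesis using assms(5) by (intro K6_edge[OF assms(1)]) auto
  qed
qed auto

lemma K6_star:
  assumes "K6 K" "cr e f" "e \<union> f \<subseteq> K" "S \<subseteq> e \<union> f" "card S = 3"
    "u \<in> K - (e \<union> f)" "v \<in> K - (e \<union> f)" "u \<noteq> v"
  obtains s t where "s \<in> S" "t \<in> S" "s \<noteq> t" "cr {u, s} {v, t}"
proof -
  obtain s1 s2 s3 where s: "S = {s1, s2, s3}" "s1 \<noteq> s2" "s1 \<noteq> s3" "s2 \<noteq> s3"
    using assms(5) by (auto simp: card_Suc_eq numeral_3_eq_3)
  have Ed: "star w S \<subseteq> Ed" if "w \<in> K - (e \<union> f)" for w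
  proof
    fix g assume "g \<in> star w S"
    then obtain s where "s \<in> S" "g = {w, s}" by blast
    then show "g \<in> Ed" using that assms(3,4) K6_edge[OF assms(1), of w s] by blast
  qed
  obtain s t where "s \<in> S" "t \<in> S" "s \<noteq> t" "cr {u, s} {v, t}"
    by (rule crossing_star[OF assms(2) _ s(2-4), of u v]) (use assms(4,6-8) Ed[OF assms(6)] Ed[OF assms(7)] s(1) in simp_all)
  then show thesis using that by blast
qed

text \<open>The two vertices off a crossing are joined to its four ends by eight edges; applying
  \<open>K6_star\<close> twice finds two crossings among them that split the four ends into
  pairs.\<close>

lemma K6_crossing_pairs:
  assumes K: "K6 K" "cr e f" "e \<union> f \<subseteq> K" "p \<in> K - (e \<union> f)" "q \<in> K - (e \<union> f)" "p \<noteq> q"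
  obtains s t m n where "e \<union> f = {s, t, m, n}" "distinct [s, t, m, n]" "cr {p, s} {q, t}" "cr {p, m} {q, n}"
proof -
  define A where "A = e \<union> f"
  note K' = K(3-5)[folded A_def]
  have A: "card A = 4" "finite A" using crossing_edges_card[OF K(2)] by (auto simp: A_def)
  then obtain S where S: "S \<subseteq> A" "card S = 3" using obtain_subset_with_card_n[of 3 A] by auto
  then obtain s t where st: "s \<in> S" "t \<in> S" "s \<noteq> t" and c1: "cr {p, s} {q, t}"
    using K6_star[OF K(1-3) _ _ K(4-6), of S] unfolding A_def by blast
  have tA: "s \<in> A" "t \<in> A" using st S by auto
  \<comment> \<open>Leaving out \<open>t\<close> prevents the second application from returning the
    first crossing.\<close>
  then have "card (A - {t}) = 3" using A by simp
  then obtain m n where mn: "m \<in> A - {t}" "n \<in> A - {t}" "m \<noteq> n" and c2: "cr {p, m} {q, n}"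
    using K6_star[OF K(1-3) _ _ K(4-6), of "A - {t}"] unfolding A_def by blast
  \<comment> \<open>Otherwise both crossings avoid some end \<open>x\<close> of the given one and
    coincide, against \<open>t \<notin> {m, n}\<close>.\<close>
  have "s \<notin> {m, n}"
  proof
    assume "s \<in> {m, n}"
    then have "{s, t, m, n} = {t, m, n}" by auto
    then have "card {s, t, m, n} < card A" using A card_length[of "[t, m, n]"] by simp
    then obtain x where x: "x \<in> A" "x \<notin> {s, t, m, n}"
      using card_mono[of "{s, t, m, n}" A] by fastforce
    have "{{p, s}, {q, t}} = {{p, m}, {q, n}}"
      by (rule K6_one_crossing[OF K(1) c1 c2, of x]) (use x tA mn K' in auto)
    then have "{q, t} = {p, m} \<or> {q, t} = {q, n}" by (metis doubleton_cases insert_commute)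
    then show False using mn tA K' by (auto simp: doubleton_eq_iff)
  qed
  then have d: "distinct [s, t, m, n]" using st mn by auto
  then have "card {s, t, m, n} = 4" by simp
  then have "{s, t, m, n} = A" using A tA mn by (intro card_subset_eq) auto
  then show thesis using that d c1 c2 A_def by blast
qed

lemma K6_prism:
  assumes K: "K6 K"
  obtains a1 a2 a3 b1 b2 b3 where "{a1, a2, a3, b1, b2, b3} = K" "prism a1 a2 a3 b1 b2 b3"
proof -
  obtain vs where vs: "distinct vs" "set vs = K"
    using K finite_distinct_list[of K] unfolding K6_def by (metis card.infinite zero_neq_numeral)
  then have "length vs = 6" using K distinct_card[of vs] unfolding K6_def by simp
  then obtain v1 v2 v3 v4 v5 v6 where v: "vs = [v1, v2, v3, v4, v5, v6]"
    by (auto simp: length_Suc_conv eval_nat_numeral)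
  have d: "distinct [v1, v2, v3, v4, v5, v6]" and Kv: "K = {v1, v2, v3, v4, v5, v6}" using vs v by auto
  have Ed: "{u, w} \<in> Ed" if "u \<in> K" "w \<in> K" "u \<noteq> w" for u w using K that unfolding K6_def by blast
  have "{u, w} \<in> Ed" if "u \<in> {v1, v2, v3}" "w \<in> {v4, v5, v6}" for u w
    using that d by (intro Ed) (auto simp: Kv)
  from K33_crossing[OF d this] obtain e f where ef: "cr e f" "e \<union> f \<subseteq> K" unfolding Kv by blast
  have "card (K - (e \<union> f)) = 2"
    using ef crossing_edges_card[OF ef(1)] K unfolding K6_def by (simp add: card_Diff_subset)
  then obtain p q where pq: "K - (e \<union> f) = {p, q}" "p \<noteq> q" by (auto simp: card_2_iff)
  obtain s t m n where A: "e \<union> f = {s, t, m, n}" "distinct [s, t, m, n]" and c1: "cr {p, s} {q, t}" and c2: "cr {p, m} {q, n}"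
    by (rule K6_crossing_pairs[OF K ef, of p q]) (use pq in auto)
  have Ke: "K = {p, q, s, t, m, n}" using pq A ef by blast
  have "p \<notin> e \<union> f" "q \<notin> e \<union> f" using pq by auto
  then have d: "distinct [p, q, s, t, m, n]" using A pq by auto
  \<comment> \<open>The crossing \<open>c1\<close> is now a centre besides \<open>m\<close> and
    \<open>n\<close>. The foot \<open>p\<close> cannot be used: for \<open>u\<close> since
    \<open>{p, m}\<close> is spent, for \<open>v\<close> since two crossings would avoid a vertex of
    \<open>{s, t}\<close>. Only the two pairings of \<open>s\<close> and \<open>t\<close>
    remain.\<close>
  obtain u v where uv: "u \<in> {p, s, t}" "v \<in> {p, s, t}" "u \<noteq> v" and c3: "cr {m, u} {n, v}"
    by (rule K6_star[OF K c1, of "{p, s, t}" m n]) (use d in \<open>auto simp: Ke\<close>)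
  have "u \<noteq> p"
  proof
    assume "u = p"
    then have "{n, v} = {q, n}" using cr_unique[OF c2] c3 by (simp add: insert_commute)
    then show False using uv d by (auto simp: doubleton_eq_iff)
  qed
  moreover have "v \<noteq> p"
  proof
    assume v: "v = p"
    obtain x where "x \<in> {s, t}" "x \<noteq> u" using d by auto
    then have "{{p, m}, {q, n}} = {{m, u}, {n, v}}" using uv d v
      by (intro K6_one_crossing[OF K c2 c3, of x]) (auto simp: Ke)
    then have "{p, m} = {m, u} \<or> {p, m} = {n, v}" by (rule doubleton_cases)
    then show False using uv d v by (auto simp: doubleton_eq_iff)
  qed
  ultimately have "u = s \<and> v = t \<or> u = t \<and> v = s" using uv by auto
  then show thesis
  proof
    assume "u = t \<and> v = s"
    then have c3: "cr {t, m} {n, s}" using c3 by (simp add: insert_commute)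
    have "prism p t n q s m" unfolding prism_def
    proof (intro conjI)
      show "\<forall>u\<in>{p, t, n, q, s, m}. \<forall>v\<in>{p, t, n, q, s, m}. u \<noteq> v \<longrightarrow> {u, v} \<in> Ed"
        using Ed unfolding Ke by auto
    qed (use d c1 c2 c3 in \<open>auto simp: insert_commute\<close>)
    then show thesis using that[of p t n q s m] by (auto simp: Ke)
  next
    \<comment> \<open>With this labelling the uncrossed edges would contain a $K_{3,3}$.\<close>
    assume "u = s \<and> v = t"
    then have c3: "cr {m, s} {n, t}" using c3 by simp
    have d': "distinct [p, m, s, t, q, n]" using d by auto
    have "{x, y} \<in> Ed" if "x \<in> {p, m, s}" "y \<in> {t, q, n}" for x y
      using that d by (intro Ed) (auto simp: Ke)
    from K33_crossing[OF d' this] obtain x x' y y'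
      where xy: "x \<in> {p, m, s}" "x' \<in> {p, m, s}" "y \<in> {t, q, n}" "y' \<in> {t, q, n}" "x \<noteq> x'"
        and c4: "cr {x, y} {x', y'}" by metis
    \<comment> \<open>The new crossing avoids the third vertex \<open>z\<close> of
      \<open>{p, m, s}\<close>, and so does exactly one of \<open>c1'\<close>, \<open>c2\<close>,
      \<open>c3'\<close>. They would coincide, but the edges of the known crossing stay within the
      two classes of the K33 and those of the new one join the classes.\<close>
    have no: False if z: "z \<in> K" "{x, x'} \<subseteq> K - {z}" "{y, y'} \<subseteq> K - {z}" "{a, b, c, d} \<subseteq> K - {z}"
      and c: "cr {a, b} {c, d}" "{a, b} \<subseteq> {p, m, s}" "{c, d} \<subseteq> {t, q, n}" for a b c d z
    proof -
      have "{{x, y}, {x', y'}} = {{a, b}, {c, d}}" using z by (intro K6_one_crossing[OF K c4 c(1), of z]) auto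
      then have "{x, y} = {a, b} \<or> {x, y} = {c, d}" by (rule doubleton_cases)
      then have "y \<in> {p, m, s} \<or> x \<in> {t, q, n}" using c by auto
      then show False using xy d by auto
    qed
    have c1': "cr {p, s} {t, q}" and c3': "cr {m, s} {t, n}" using c1 c3 by (simp_all add: insert_commute)
    have sub: "{x, x'} \<subseteq> K - {z}" if "z \<in> {p, m, s}" "z \<noteq> x" "z \<noteq> x'" for z using that xy by (auto simp: Ke)
    have sub': "{y, y'} \<subseteq> K - {z}" if "z \<in> {p, m, s}" for z using that xy d by (auto simp: Ke)
    obtain z where z: "z \<in> {p, m, s}" "z \<noteq> x" "z \<noteq> x'" using xy d by auto
    note sub = sub[OF z] sub'[OF z(1)]
    consider "z = p" | "z = m" | "z = s" using z(1) by blast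
    then have False
    proof cases
      case 1 then show False using d by (intro no[OF _ sub _ c3']) (auto simp: Ke)
    next
      case 2 then show False using d by (intro no[OF _ sub _ c1']) (auto simp: Ke)
    next
      case 3 then show False using d by (intro no[OF _ sub _ c2]) (auto simp: Ke)
    qed
    then show thesis by blast
  qed
qed

lemma crossings_share3:
  assumes cr: "cr e f" "cr g h" and ef: "e \<union> f = {s1, s2, s3, y}" and gh: "g \<union> h = {s1, s2, s3, z}"
    and ne: "y \<noteq> z" "x \<notin> {s1, s2, s3, y, z}" and Ed: "{x, s1} \<in> Ed" "{x, s2} \<in> Ed" "{x, s3} \<in> Ed"
  shows False
proof -
  have c3: "card {s1, s2, s3} \<le> 3" using card_length[of "[s1, s2, s3]"] by simp
  \<comment> \<open>A crossing has four different ends, so \<open>y\<close> tells the two sets of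
    ends apart.\<close>
  have y: "y \<notin> {s1, s2, s3}"
  proof
    assume "y \<in> {s1, s2, s3}"
    then have "e \<union> f = {s1, s2, s3}" using ef by auto
    then show False using crossing_edges_card(1)[OF cr(1)] c3 by simp
  qed
  have "{e, f} = {g, h}"
  proof (rule two_crossings[OF cr])
    show "e \<union> f \<union> g \<union> h \<subseteq> {s1, s2, s3, y, z}" using ef gh by blast
    show "card {s1, s2, s3, y, z} \<le> 5" using card_length[of "[s1, s2, s3, y, z]"] by simp
    show "{x, s} \<in> Ed" if "s \<in> (e \<union> f) \<inter> (g \<union> h)" for s
      using that ef gh ne y Ed by auto
  qed (use ne in auto)
  then have "\<Union> {e, f} = \<Union> {g, h}" by (rule arg_cong)
  then have "{s1, s2, s3, y} = {s1, s2, s3, z}" using ef gh by simp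
  then show False using y ne by blast
qed

text \<open>Applied with a vertex \<open>w\<close> outside the prism: an edge \<open>g\<close> that
  is already crossed within the prism cannot be crossed by an edge at \<open>w\<close>.\<close>

lemma cr_cr_mem: "cr e g \<Longrightarrow> cr g h \<Longrightarrow> w \<in> e \<Longrightarrow> w \<in> h"
  using cr_unique[of g e h] cr_sym[of e g] by simp

section \<open>Symmetries and crossings of the prism\<close>

lemma prism_swap:
  assumes "prism a1 a2 a3 b1 b2 b3"
  shows "prism a2 a1 a3 b2 b1 b3"
  using assms cr_sym[of "{a1, b2}" "{a2, b1}"] unfolding prism_def by auto

lemma prism_rotate:
  assumes "prism a1 a2 a3 b1 b2 b3"
  shows "prism a2 a3 a1 b2 b3 b1"
  using assms cr_sym[of "{a1, b2}" "{a2, b1}"] cr_sym[of "{a1, b3}" "{a3, b1}"] unfolding prism_def by auto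

lemma prism_flip:
  assumes "prism a1 a2 a3 b1 b2 b3"
  shows "prism b1 b2 b3 a1 a2 a3"
  using assms cr_sym[of "{a1, b2}" "{a2, b1}"] cr_sym[of "{a1, b3}" "{a3, b1}"] cr_sym[of "{a2, b3}" "{a3, b2}"]
  unfolding prism_def by (auto simp: insert_commute)

lemma prism_K6: "prism a1 a2 a3 b1 b2 b3 \<Longrightarrow> K6 {a1, a2, a3, b1, b2, b3}"
  unfolding prism_def K6_def by simp

lemma prism_edges:
  assumes "prism a1 a2 a3 b1 b2 b3"
  shows "u \<in> {a1, a2, a3, b1, b2, b3} \<Longrightarrow> v \<in> {a1, a2, a3, b1, b2, b3} \<Longrightarrow> u \<noteq> v \<Longrightarrow> {u, v} \<in> Ed"
  by (rule K6_edge[OF prism_K6[OF assms]])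

text \<open>Some vertex \<open>z\<close> of the prism is not an end of the crossing. It lies on one
  rung, and the quadrangle of the two other rungs has a crossing that avoids \<open>z\<close> too;
  five vertices carry only one.\<close>

lemma prism_only:
  assumes P: "prism a1 a2 a3 b1 b2 b3" and cr: "cr {u, v} {x, y}" "{u, v, x, y} \<subseteq> {a1, a2, a3, b1, b2, b3}"
  shows "{u, v} \<in> {{a1, b2}, {a2, b1}, {a1, b3}, {a3, b1}, {a2, b3}, {a3, b2}}"
proof -
  let ?K = "{a1, a2, a3, b1, b2, b3}"
  note K = prism_K6[OF P]
  have c: "cr {a1, b2} {a2, b1}" "cr {a1, b3} {a3, b1}" "cr {a2, b3} {a3, b2}" and d: "distinct [a1, a2, a3, b1, b2, b3]"
    using P unfolding prism_def by auto
  have "card {u, v, x, y} < card ?K" using card_length[of "[u, v, x, y]"] d by simp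
  then obtain z where z: "z \<in> ?K" "z \<notin> {u, v, x, y}"
    using card_mono[of "{u, v, x, y}" ?K] cr(2) by (metis finite.emptyI finite.insertI leD subsetI)
  have s: "{u, v} \<union> {x, y} \<subseteq> ?K - {z}" using z cr(2) by auto
  consider "z \<in> {a3, b3}" | "z \<in> {a2, b2}" | "z \<in> {a1, b1}" using z by blast
  then show ?thesis
  proof cases
    case 1
    then have "{{u, v}, {x, y}} = {{a1, b2}, {a2, b1}}"
      using s d by (intro K6_one_crossing[OF K cr(1) c(1), of z]) auto
    then have "{u, v} = {a1, b2} \<or> {u, v} = {a2, b1}" by (rule doubleton_cases)
    then show ?thesis by (elim disjE) simp_all
  next
    case 2
    then have "{{u, v}, {x, y}} = {{a1, b3}, {a3, b1}}"
      using s d by (intro K6_one_crossing[OF K cr(1) c(2), of z]) auto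
    then have "{u, v} = {a1, b3} \<or> {u, v} = {a3, b1}" by (rule doubleton_cases)
    then show ?thesis by (elim disjE) simp_all
  next
    case 3
    then have "{{u, v}, {x, y}} = {{a2, b3}, {a3, b2}}"
      using s d by (intro K6_one_crossing[OF K cr(1) c(3), of z]) auto
    then have "{u, v} = {a2, b3} \<or> {u, v} = {a3, b2}" by (rule doubleton_cases)
    then show ?thesis by (elim disjE) simp_all
  qed
qed

text \<open>Three neighbours of \<open>w\<close> among the ends of one crossing already fix two
  crossings at \<open>w\<close>: that crossing is a centre besides \<open>w\<close> and
  \<open>b2\<close>, then besides \<open>w\<close> and \<open>a2\<close>.\<close>

lemma prism_crossings_apex:
  assumes P: "prism a1 a2 a3 b1 b2 b3" and w: "w \<notin> {a1, a2, a3, b1, b2, b3}"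
    "{w, a1} \<in> Ed" "{w, a3} \<in> Ed" "{w, b3} \<in> Ed"
  shows "cr {w, a1} {b2, b3}" "cr {w, a3} {a1, a2}"
proof -
  have c12: "cr {a1, b2} {a2, b1}" and c13: "cr {a1, b3} {a3, b1}" and c23: "cr {a2, b3} {a3, b2}"
    and d: "distinct [a1, a2, a3, b1, b2, b3]"
    using P unfolding prism_def by auto
  note E = prism_edges[OF P]
  \<comment> \<open>The edges from \<open>b2\<close> to \<open>a1\<close> and \<open>a3\<close> are
    spent diagonals, so \<open>t\<close> must be \<open>b3\<close>. For \<open>s = a3\<close> the
    crossing would share three ends with \<open>c23\<close>.\<close>
  obtain s t where st: "s \<in> {a1, a3, b3}" "t \<in> {a1, a3, b3}" "s \<noteq> t" and c: "cr {w, s} {b2, t}"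
    by (rule crossing_star[OF c13, of a1 a3 b3 w b2]) (use d w E in auto)
  have "t \<noteq> a1" using cr_cr_mem[OF c, of "{a2, b1}" w] c12 w(1) by (auto simp: insert_commute)
  moreover have "t \<noteq> a3" using cr_cr_mem[OF c, of "{a2, b3}" w] cr_sym[OF c23] w(1) by (auto simp: insert_commute)
  ultimately have t: "t = b3" using st by blast
  have "s \<noteq> a3"
  proof
    assume "s = a3"
    then have "cr {w, a3} {b2, b3}" using c t by simp
    then show False using d w(1) E by (intro crossings_share3[OF _ c23, of _ _ a3 b2 b3 w a2 a1]) auto
  qed
  then show 1: "cr {w, a1} {b2, b3}" using c st t by blast
  \<comment> \<open>Here \<open>{a2, b3}\<close> is spent as a diagonal and \<open>{w, a1}\<close>
    by the first part. For \<open>s = b3\<close> three ends are shared with the crossing just found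
    or with \<open>c23\<close>.\<close>
  obtain s t where st: "s \<in> {a1, a3, b3}" "t \<in> {a1, a3, b3}" "s \<noteq> t" and c: "cr {w, s} {a2, t}"
    by (rule crossing_star[OF c13, of a1 a3 b3 w a2]) (use d w E in auto)
  have "t \<noteq> b3" using cr_cr_mem[OF c, of "{a3, b2}" w] c23 w(1) by auto
  moreover have "s \<noteq> a1"
  proof
    assume "s = a1"
    then have "{a2, t} = {b2, b3}" using c 1 cr_unique by blast
    then show False using d by (auto simp: doubleton_eq_iff)
  qed
  moreover have False if "s = b3" "t = a1"
  proof -
    have "cr {w, b3} {a1, a2}" using c that by (simp add: insert_commute)
    then show False using d w E by (intro crossings_share3[OF _ 1, of _ _ w b3 a1 a2 b2 a3]) (auto simp: insert_commute)
  qed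
  moreover have False if "s = b3" "t = a3"
  proof -
    have "cr {w, b3} {a2, a3}" using c that by simp
    then show False using d w E by (intro crossings_share3[OF _ c23, of _ _ b3 a2 a3 w b2 a1]) (auto simp: insert_commute)
  qed
  ultimately have "s = a3" "t = a1" using st by auto
  then show "cr {w, a3} {a1, a2}" using c by (simp add: insert_commute)
qed

text \<open>First type of four neighbours: the two vertices left out, \<open>a3\<close> and
  \<open>b3\<close>, form a rung. The crossing forced by \<open>step\<close> and its image under a
  half turn share \<open>w\<close>, \<open>a1\<close>, \<open>b2\<close>, and \<open>a2\<close> is
  adjacent to all three.\<close>

lemma prism_apex_rung:
  assumes P: "prism a1 a2 a3 b1 b2 b3" and w: "w \<notin> {a1, a2, a3, b1, b2, b3}"
    "{w, a1} \<in> Ed" "{w, b1} \<in> Ed" "{w, a2} \<in> Ed" "{w, b2} \<in> Ed"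
  shows False
proof -
  have step: "cr {w, b2} {a3, a1}" if P: "prism a1 a2 a3 b1 b2 b3" and w: "w \<notin> {a1, a2, a3, b1, b2, b3}"
    "{w, a1} \<in> Ed" "{w, b1} \<in> Ed" "{w, a2} \<in> Ed" "{w, b2} \<in> Ed" for a1 a2 a3 b1 b2 b3
  proof -
    have c12: "cr {a1, b2} {a2, b1}" and c13: "cr {a1, b3} {a3, b1}" and c23: "cr {a2, b3} {a3, b2}"
      and d: "distinct [a1, a2, a3, b1, b2, b3]"
      using P unfolding prism_def by auto
    note E = prism_edges[OF P]
    obtain s t where st: "s \<in> {a1, b1, b2}" "t \<in> {a1, b1, b2}" "s \<noteq> t" and c: "cr {w, s} {a3, t}"
      by (rule crossing_star[OF c12, of a1 b1 b2 w a3]) (use d w E in auto)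
    have "t \<noteq> b1" using cr_cr_mem[OF c, of "{a1, b3}" w] cr_sym[OF c13] w(1) by auto
    moreover have "t \<noteq> b2" using cr_cr_mem[OF c, of "{a2, b3}" w] cr_sym[OF c23] w(1) by auto
    ultimately have t: "t = a1" using st by blast
    have "s \<noteq> b1"
    proof
      assume "s = b1"
      then have "cr {w, b1} {a3, a1}" using c t by simp
      then show False using d w E by (intro crossings_share3[OF _ c13, of _ _ b1 a3 a1 w b3 a2]) auto
    qed
    then show ?thesis using c st t by blast
  qed
  have d: "distinct [a1, a2, a3, b1, b2, b3]" using P unfolding prism_def by auto
  note E = prism_edges[OF P]
  have 1: "cr {w, b2} {a3, a1}" using step[OF P] w by simp
  \<comment> \<open>The half turn exchanges \<open>a1\<close> with \<open>b2\<close>,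
    \<open>a2\<close> with \<open>b1\<close> and \<open>a3\<close> with \<open>b3\<close>.\<close>
  have 2: "cr {w, a1} {b3, b2}" using step[OF prism_swap[OF prism_flip[OF P]]] w by auto
  show False using d w E by (intro crossings_share3[OF 1 2, of w b2 a1 a3 b3 a2]) (auto simp: insert_commute)
qed

text \<open>Second type: the vertices left out, \<open>a2\<close> and \<open>b1\<close>, form a
  diagonal. The half turn again supplies a second crossing; the shared ends are \<open>w\<close>,
  \<open>a1\<close>, \<open>a3\<close>, with common neighbour \<open>b3\<close>.\<close>

lemma prism_apex_mixed:
  assumes P: "prism a1 a2 a3 b1 b2 b3" and w: "w \<notin> {a1, a2, a3, b1, b2, b3}"
    "{w, a1} \<in> Ed" "{w, b2} \<in> Ed" "{w, a3} \<in> Ed" "{w, b3} \<in> Ed"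
  shows False
proof -
  have d: "distinct [a1, a2, a3, b1, b2, b3]" using P unfolding prism_def by auto
  note E = prism_edges[OF P]
  have 1: "cr {w, a3} {a1, a2}" using prism_crossings_apex[OF P] w by simp
  have 2: "cr {w, b2} {a1, a3}" using prism_crossings_apex(1)[OF prism_swap[OF prism_flip[OF P]]] w by auto
  show False using d w E by (intro crossings_share3[OF 1 2, of w a3 a1 a2 b2 b3]) (auto simp: insert_commute)
qed

text \<open>Third type: the vertices left out, \<open>b1\<close> and \<open>b2\<close>, form an edge
  of a triangle. The forced crossings \<open>w1\<close> and \<open>w3\<close> share only
  \<open>w\<close> and \<open>a1\<close>, so a K33 is built anew: its feet are \<open>w\<close>,
  \<open>a1\<close>, \<open>a2\<close>, its centres are \<open>a3\<close> and these two crossings.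
  The leg from \<open>a3\<close> to \<open>w\<close> runs through \<open>b3\<close>, the one from
  \<open>w1\<close> to \<open>a2\<close> through \<open>b2\<close>.\<close>

lemma prism_apex_triangle:
  assumes P: "prism a1 a2 a3 b1 b2 b3" and w: "w \<notin> {a1, a2, a3, b1, b2, b3}"
    "{w, a1} \<in> Ed" "{w, a2} \<in> Ed" "{w, a3} \<in> Ed" "{w, b3} \<in> Ed"
  shows False
proof -
  have c13: "cr {a1, b3} {a3, b1}" and c23: "cr {a2, b3} {a3, b2}" and d: "distinct [a1, a2, a3, b1, b2, b3]"
    using P unfolding prism_def by auto
  note E = prism_edges[OF P]
  have w1: "cr {w, a1} {b2, b3}" and w3: "cr {w, a3} {a1, a2}" using prism_crossings_apex[OF P] w by simp_all
  have n1: "\<not> cr {b3, w} {a3, a1}"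
  proof
    assume "cr {b3, w} {a3, a1}"
    then show False using d w E by (intro crossings_share3[OF _ c13, of _ _ b3 a3 a1 w b1 a2]) (auto simp: insert_commute)
  qed
  have n2: "\<not> cr {b3, w} {a3, a2}"
  proof
    assume "cr {b3, w} {a3, a2}"
    then show False using d w E by (intro crossings_share3[OF _ c23, of _ _ b3 a3 a2 w b2 a1]) (auto simp: insert_commute)
  qed
  have n3: "\<not> cr {b3, w} {b2, a2}"
  proof
    assume "cr {b3, w} {b2, a2}"
    then show False using d w E by (intro crossings_share3[OF _ c23, of _ _ b3 b2 a2 w a3 a1]) (auto simp: insert_commute)
  qed
  \<comment> \<open>\<open>{a2, b2}\<close> is a rung, and the only crossed edges within the prism
    are diagonals.\<close>
  have n4: "\<not> cr {b2, a2} {x, y}" if "x \<in> {a1, a2, a3, b1, b2, b3}" "y \<in> {a1, a2, a3, b1, b2, b3}" for x y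
    using prism_only[OF P, of b2 a2 x y] that d by (auto simp: doubleton_eq_iff)
  have w1': "f \<in> {{w, a1}, {b2, b3}}" if "g \<in> {{w, a1}, {b2, b3}}" "cr f g \<or> cr g f" for f g
    using cr_pair_closed[OF w1 that(1)] that(2) by blast
  have w3': "f \<in> {{w, a3}, {a1, a2}}" if "g \<in> {{w, a3}, {a1, a2}}" "cr f g \<or> cr g f" for f g
    using cr_pair_closed[OF w3 that(1)] that(2) by blast
  have adj: "\<not> cr {b3, w} {a3, b3}" using cr_edges by blast
  have "tri (star a3 {b3, a1, a2}) {a3, b3, a1, a2} b3 a1 a2"
    using d E by (intro tri_star) auto
  then have t1: "tri (insert {b3, w} (star a3 {b3, a1, a2})) (insert w {a3, b3, a1, a2}) w a1 a2"
    using d w n1 n2 adj by (intro tri_extend) (auto simp: doubleton_eq_iff insert_commute)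
  have "tri {{w, a1}, {b2, b3}} {b2, w, a1} b2 w a1"
    using d w by (intro tri_crossing_edges[OF w1]) auto
  moreover have "\<not> cr {b2, a2} f" if "f \<in> {{w, a1}, {b2, b3}}" for f
    using w1'[OF that, of "{b2, a2}"] d w(1) by (auto simp: doubleton_eq_iff)
  ultimately have "tri (insert {b2, a2} {{w, a1}, {b2, b3}}) (insert a2 {b2, w, a1}) a2 w a1"
    using d w E by (intro tri_extend) (auto simp: doubleton_eq_iff)
  then have t2: "tri (insert {b2, a2} {{w, a1}, {b2, b3}}) (insert a2 {b2, w, a1}) w a1 a2"
    by (rule tri_swap(2)[OF tri_swap(1)])
  have t3: "tri {{w, a3}, {a1, a2}} {w, a1, a2} w a1 a2"
    using d w by (intro tri_crossing_edges[OF w3]) auto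
  define F1 F2 F3 where F: "F1 = insert {b3, w} (star a3 {b3, a1, a2})"
    "F2 = insert {b2, a2} {{w, a1}, {b2, b3}}" "F3 = {{w, a3}, {a1, a2}}"
  have D: "F1 \<inter> F2 = {}" "F1 \<inter> F3 = {}" "F2 \<inter> F3 = {}"
    unfolding F using d w(1) by (simp_all add: doubleton_eq_iff) blast+
  have no3: False if "e \<notin> F3" "f \<in> F3" "cr e f" for e f
    using w3'[of f e] that unfolding F by blast
  show False
  proof (rule tri_K33_False[OF t1 t2 t3, folded F, OF D])
    \<comment> \<open>\<open>b3\<close> and \<open>a3\<close> lie on the first tripod. The second
      uses \<open>{b2, b3}\<close> only up to the crossing and the third uses \<open>{w, a3}\<close>
      only up to the crossing, so neither vertex is repeated.\<close>
    show "insert w {a3, b3, a1, a2} \<inter> insert a2 {b2, w, a1} \<subseteq> {w, a1, a2}" using d w(1) by auto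
    show "insert w {a3, b3, a1, a2} \<inter> {w, a1, a2} \<subseteq> {w, a1, a2}"
      "insert a2 {b2, w, a1} \<inter> {w, a1, a2} \<subseteq> {w, a1, a2}" by auto
    show "\<not> cr e f" if "e \<in> F1" "f \<in> F2" for e f
    proof
      assume c: "cr e f"
      have "f \<noteq> {b2, a2}"
        using that(1) c cr_sym[OF c] n3 n4 unfolding F by auto
      then have "f \<in> {{w, a1}, {b2, b3}}" using that(2) unfolding F by blast
      then have "e \<in> {{w, a1}, {b2, b3}}" using w1' c by blast
      then have "e \<in> F2" unfolding F by blast
      then show False using that(1) D(1) by blast
    qed
    show "\<not> cr e f" if "e \<in> F1" "f \<in> F3" for e f using no3[of e f] that D(2) by blast
    show "\<not> cr e f" if "e \<in> F2" "f \<in> F3" for e f using no3[of e f] that D(3) by blast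
  qed
qed

lemma K6_no_apex:
  assumes K: "K6 K" and w: "w \<notin> K" "4 \<le> card {x \<in> K. {w, x} \<in> Ed}"
  shows False
proof -
  obtain a1 a2 a3 b1 b2 b3 where Ke: "{a1, a2, a3, b1, b2, b3} = K" and P: "prism a1 a2 a3 b1 b2 b3"
    using K6_prism[OF K] .
  define N where "N x \<longleftrightarrow> {w, x} \<in> Ed" for x
  \<comment> \<open>One excluded quadruple for each type of omitted pair: rung, diagonal, triangle
    edge. The 12 symmetries of the prism, four from \<open>all\<close> times three rotations, carry
    them to all 15 quadruples.\<close>
  let ?P = "\<lambda>a1 a2 a3 b1 b2 b3. \<not> (N a1 \<and> N b1 \<and> N a2 \<and> N b2) \<and> \<not> (N a1 \<and> N b2 \<and> N a3 \<and> N b3) \<and>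
    \<not> (N a1 \<and> N a2 \<and> N a3 \<and> N b3)"
  have cases: "?P a1 a2 a3 b1 b2 b3" if "prism a1 a2 a3 b1 b2 b3" "{a1, a2, a3, b1, b2, b3} = K" for a1 a2 a3 b1 b2 b3
    using prism_apex_rung[OF that(1), of w] prism_apex_mixed[OF that(1), of w] prism_apex_triangle[OF that(1), of w]
      w(1) that(2) unfolding N_def by blast
  have all: "?P a1 a2 a3 b1 b2 b3 \<and> ?P a2 a1 a3 b2 b1 b3 \<and> ?P b1 b2 b3 a1 a2 a3 \<and> ?P b2 b1 b3 a2 a1 a3"
    if "prism a1 a2 a3 b1 b2 b3" "{a1, a2, a3, b1, b2, b3} = K" for a1 a2 a3 b1 b2 b3
  proof -
    have "{a2, a1, a3, b2, b1, b3} = K" "{b1, b2, b3, a1, a2, a3} = K" "{b2, b1, b3, a2, a1, a3} = K"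
      using that(2) by auto
    note c = cases[OF that] cases[OF prism_swap[OF that(1)] this(1)] cases[OF prism_flip[OF that(1)] this(2)]
      cases[OF prism_swap[OF prism_flip[OF that(1)]] this(3)]
    show ?thesis by (rule conjI[OF c(1) conjI[OF c(2) conjI[OF c(3,4)]]])
  qed
  have d: "distinct [a1, a2, a3, b1, b2, b3]" using P unfolding prism_def by auto
  have "card {x \<in> K. N x} + card {x \<in> K. \<not> N x} = 6"
  proof -
    have "finite K" using K unfolding K6_def by (simp add: card_ge_0_finite)
    then have "card {x \<in> K. N x} + card {x \<in> K. \<not> N x} = card ({x \<in> K. N x} \<union> {x \<in> K. \<not> N x})"
      by (intro card_Un_disjoint[symmetric]) auto
    also have "{x \<in> K. N x} \<union> {x \<in> K. \<not> N x} = K" by auto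
    finally show ?thesis using K unfolding K6_def by simp
  qed
  then have le2: "card {x \<in> K. \<not> N x} \<le> 2" using w(2) unfolding N_def by linarith
  have two: "N x \<or> N y \<or> N z" if "x \<in> K" "y \<in> K" "z \<in> K" "x \<noteq> y" "x \<noteq> z" "y \<noteq> z" for x y z
  proof (rule ccontr)
    assume n: "\<not> (N x \<or> N y \<or> N z)"
    have "card {x, y, z} \<le> card {x \<in> K. \<not> N x}"
      using that n K unfolding K6_def by (intro card_mono) (auto simp: card_ge_0_finite)
    then show False using that le2 by simp
  qed
  have r: "prism a2 a3 a1 b2 b3 b1" "prism a3 a1 a2 b3 b1 b2"
    using prism_rotate[OF P] prism_rotate[OF prism_rotate[OF P]] by auto
  have Kr: "{a2, a3, a1, b2, b3, b1} = K" "{a3, a1, a2, b3, b1, b2} = K" using Ke by auto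
  note A = all[OF P Ke] all[OF r(1) Kr(1)] all[OF r(2) Kr(2)]
  have mem: "a1 \<in> K" "a2 \<in> K" "a3 \<in> K" "b1 \<in> K" "b2 \<in> K" "b3 \<in> K" using Ke by auto
  note T = two[of a1 a2 a3] two[of a1 a2 b1] two[of a1 a2 b2] two[of a1 a2 b3] two[of a1 a3 b1] two[of a1 a3 b2]
    two[of a1 a3 b3] two[of a1 b1 b2] two[of a1 b1 b3] two[of a1 b2 b3] two[of a2 a3 b1] two[of a2 a3 b2]
    two[of a2 a3 b3] two[of a2 b1 b2] two[of a2 b1 b3] two[of a2 b2 b3] two[of a3 b1 b2] two[of a3 b1 b3]
    two[of a3 b2 b3] two[of b1 b2 b3]
  \<comment> \<open>\<open>T\<close> runs through all 20 triples, so at most two vertices are not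
    adjacent to \<open>w\<close>; what remains is propositional.\<close>
  have "a1 \<noteq> a2" "a1 \<noteq> a3" "a1 \<noteq> b1" "a1 \<noteq> b2" "a1 \<noteq> b3" "a2 \<noteq> a3" "a2 \<noteq> b1" "a2 \<noteq> b2" "a2 \<noteq> b3"
    "a3 \<noteq> b1" "a3 \<noteq> b2" "a3 \<noteq> b3" "b1 \<noteq> b2" "b1 \<noteq> b3" "b2 \<noteq> b3" using d by auto
  then show False using A T mem by satx
qed

end

section \<open>Chordal graphs and 4-trees\<close>

text \<open>A shortest walk: a repeated vertex or a forward shortcut could be cut out by splicing
  \<open>pre\<close> and \<open>post\<close>.\<close>

lemma induced_path:
  assumes "T\<^sup>*\<^sup>* x y"
  obtains q :: "nat \<Rightarrow> 'a" and n where "q 0 = x" "q n = y" "\<And>i. i < n \<Longrightarrow> T (q i) (q (Suc i))"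
    "inj_on q {..n}" "\<And>i j. i < j \<Longrightarrow> j \<le> n \<Longrightarrow> T (q i) (q j) \<Longrightarrow> j = Suc i"
proof -
  define n where "n = (LEAST n. (T ^^ n) x y)"
  have n: "(T ^^ n) x y" unfolding n_def using rtranclp_imp_relpowp[OF assms] by (auto intro: LeastI)
  have least: "n \<le> m" if "(T ^^ m) x y" for m unfolding n_def using that by (rule Least_le)
  obtain q where q: "q 0 = x" "q n = y" "\<And>i. i < n \<Longrightarrow> T (q i) (q (Suc i))"
    using n unfolding relpowp_fun_conv by blast
  have pre: "(T ^^ i) x (q i)" if "i \<le> n" for i
    unfolding relpowp_fun_conv using q that by (intro exI[of _ q]) auto
  have post: "(T ^^ (n - j)) (q j) y" if "j \<le> n" for j
    unfolding relpowp_fun_conv using q that by (intro exI[of _ "\<lambda>m. q (m + j)"]) auto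
  have step: "j \<le> Suc i" if "i < j" "j \<le> n" "T (q i) (q j)" for i j
  proof -
    have "(T ^^ Suc i) x (q j)" using pre[of i] that by auto
    then have "(T ^^ (Suc i + (n - j))) x y" using post[of j] that unfolding relpowp_add by blast
    from least[OF this] show ?thesis using that by linarith
  qed
  have eq: False if "i < j" "j \<le> n" "q i = q j" for i j
  proof -
    have "(T ^^ (i + (n - j))) x y" using pre[of i] post[of j] that unfolding relpowp_add by auto
    from least[OF this] show False using that by linarith
  qed
  show thesis
  proof (rule that[of q n])
    show "inj_on q {..n}" using eq by (auto intro!: linorder_inj_onI)
    show "j = Suc i" if "i < j" "j \<le> n" "T (q i) (q j)" for i j using step[OF that] that by simp
  qed (use q in auto)
qed

locale simple_graph =
  fixes adj :: "'a \<Rightarrow> 'a \<Rightarrow> bool"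
  assumes adj_sym: "adj u v \<Longrightarrow> adj v u" and adj_irrefl: "\<not> adj u u"
begin

text \<open>\<open>n\<close> is the last index, so the cycle has \<open>n + 1\<close> vertices and
  the bound 3 means length at least 4.\<close>

definition hole :: "(nat \<Rightarrow> 'a) \<Rightarrow> nat \<Rightarrow> bool" where
  "hole p n \<longleftrightarrow> 3 \<le> n \<and> inj_on p {..n} \<and> adj (p n) (p 0) \<and> (\<forall>i<n. adj (p i) (p (Suc i))) \<and>
     (\<forall>i j. i < j \<longrightarrow> j \<le> n \<longrightarrow> adj (p i) (p j) \<longrightarrow> j = Suc i \<or> i = 0 \<and> j = n)"

definition nbrs :: "'a set \<Rightarrow> 'a \<Rightarrow> 'a set" where
  "nbrs U u = {x \<in> U. adj u x}"

definition complete_on :: "'a set \<Rightarrow> bool" where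
  "complete_on S \<longleftrightarrow> (\<forall>u\<in>S. \<forall>v\<in>S. u \<noteq> v \<longrightarrow> adj u v)"

abbreviation step_in :: "'a set \<Rightarrow> 'a \<Rightarrow> 'a \<Rightarrow> bool" where
  "step_in X a b \<equiv> a \<in> X \<and> b \<in> X \<and> adj a b"

definition connected_on :: "'a set \<Rightarrow> bool" where
  "connected_on X \<longleftrightarrow> (\<forall>a\<in>X. \<forall>b\<in>X. (step_in X)\<^sup>*\<^sup>* a b)"

lemma complete_onD: "complete_on S \<Longrightarrow> u \<in> S \<Longrightarrow> v \<in> S \<Longrightarrow> u \<noteq> v \<Longrightarrow> adj u v"
  unfolding complete_on_def by blast

lemma complete_on_subset: "complete_on S \<Longrightarrow> R \<subseteq> S \<Longrightarrow> complete_on R"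
  unfolding complete_on_def by blast

lemma complete_on_insert: "complete_on S \<Longrightarrow> (\<And>x. x \<in> S \<Longrightarrow> adj u x) \<Longrightarrow> complete_on (insert u S)"
  unfolding complete_on_def using adj_sym by blast

text \<open>A shortest path from \<open>x\<close> to \<open>y\<close> through \<open>C\<close> has
  at least one inner vertex, and \<open>v\<close> sees only its ends. Putting \<open>v\<close> in
  front closes it to a chordless cycle.\<close>

lemma hole_from_path:
  assumes T: "(step_in (insert x (insert y C)))\<^sup>*\<^sup>* x y"
    and xy: "x \<noteq> y" "\<not> adj x y" "adj v x" "adj v y"
    and v: "v \<notin> C" "\<And>c. c \<in> C \<Longrightarrow> \<not> adj v c"
  obtains p n where "hole p n"
proof -
  obtain q n where q: "q 0 = x" "q n = y" "\<And>i. i < n \<Longrightarrow> step_in (insert x (insert y C)) (q i) (q (Suc i))"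
    "inj_on q {..n}" "\<And>i j. i < j \<Longrightarrow> j \<le> n \<Longrightarrow> step_in (insert x (insert y C)) (q i) (q j) \<Longrightarrow> j = Suc i"
    using induced_path[OF T] by blast
  have n0: "n \<noteq> 0" using q(1,2) xy(1) by metis
  have n1: "n \<noteq> 1" using q(1,2) q(3)[of 0] xy by auto
  have n: "2 \<le> n" using n0 n1 by linarith
  have dom: "q i \<in> insert x (insert y C)" if "i \<le> n" for i
  proof (cases "i < n")
    case False
    then have "q i = y" using that q(2) by simp
    then show ?thesis by simp
  qed (use q(3) in blast)
  have vq: "i = 0 \<or> i = n" if "i \<le> n" "adj v (q i)" for i
  proof -
    have "q i = x \<or> q i = y" using dom[OF that(1)] v(2) that(2) by blast
    then have "q i = q 0 \<or> q i = q n" using q(1,2) by simp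
    then show ?thesis using inj_onD[OF q(4), of i 0] inj_onD[OF q(4), of i n] that(1) by auto
  qed
  have vn: "v \<noteq> q i" if "i \<le> n" for i
    using dom[OF that] v(1) xy adj_irrefl by auto
  define p where "p i = (case i of 0 \<Rightarrow> v | Suc j \<Rightarrow> q j)" for i
  have "hole p (Suc n)"
    unfolding hole_def
  proof (intro conjI allI impI)
    show "3 \<le> Suc n" using n by simp
    show "inj_on p {..Suc n}"
    proof (rule inj_onI)
      fix i j assume "i \<in> {..Suc n}" "j \<in> {..Suc n}" "p i = p j"
      then show "i = j"
        using inj_onD[OF q(4)] vn vn[symmetric] by (cases i; cases j) (auto simp: p_def)
    qed
    show "adj (p (Suc n)) (p 0)" using adj_sym[OF xy(4)] q(2) by (simp add: p_def)
    show "adj (p i) (p (Suc i))" if "i < Suc n" for i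
      using that q(1) q(3) xy(3) by (cases i) (auto simp: p_def)
    show "j = Suc i \<or> i = 0 \<and> j = Suc n" if ij: "i < j" "j \<le> Suc n" "adj (p i) (p j)" for i j
    proof -
      obtain j' where j: "j = Suc j'" using ij(1) by (cases j) auto
      show ?thesis
      proof (cases i)
        case 0
        then show ?thesis using vq[of j'] ij j by (auto simp: p_def)
      next
        case (Suc i')
        then have "j' = Suc i'" using q(5)[of i' j'] ij j dom[of i'] dom[of j'] by (auto simp: p_def)
        then show ?thesis using Suc j by simp
      qed
    qed
  qed
  then show thesis by (rule that)
qed

lemma step_in_rtranclp_mono: "(step_in X)\<^sup>*\<^sup>* a b \<Longrightarrow> X \<subseteq> Y \<Longrightarrow> (step_in Y)\<^sup>*\<^sup>* a b"
  by (rule mono_rtranclp[rule_format, of "step_in X" "step_in Y"]) blast+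

lemma step_in_rtranclp_sym: "(step_in X)\<^sup>*\<^sup>* a b \<Longrightarrow> (step_in X)\<^sup>*\<^sup>* b a"
proof (induction rule: rtranclp_induct)
  case (step y z)
  then have "step_in X z y" using adj_sym by blast
  then show ?case using step.IH by (rule converse_rtranclp_into_rtranclp)
qed simp

text \<open>
  Dirac's theorem. Let \<open>C\<close> be a component of the graph induced on the non-neighbours of \<open>v\<close>. Its
  attachments \<open>S\<close> form a clique, since two nonadjacent ones would lie on a hole through \<open>C\<close> and \<open>v\<close>.
  By induction \<open>C \<union> S\<close> has a simplicial vertex in \<open>C\<close>.
\<close>

lemma simplicial_vertex:
  assumes "\<And>p n. \<not> hole p n" "finite U" "v \<in> U" "x \<in> U" "x \<noteq> v" "\<not> adj v x"
  shows "\<exists>z\<in>U. z \<noteq> v \<and> \<not> adj v z \<and> complete_on (nbrs U z)"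
  using assms(2-)
proof (induction "card U" arbitrary: U v x rule: less_induct)
  case less
  define W where "W = {z \<in> U. z \<noteq> v \<and> \<not> adj v z}"
  define C where "C = {c. (step_in W)\<^sup>*\<^sup>* x c}"
  define S where "S = {s \<in> U - C. \<exists>c\<in>C. adj c s}"
  have xW: "x \<in> W" using less.prems unfolding W_def by blast
  have CW: "C \<subseteq> W"
  proof
    fix c assume "c \<in> C"
    then have "(step_in W)\<^sup>*\<^sup>* x c" unfolding C_def by simp
    then show "c \<in> W" by (cases rule: rtranclp.cases) (use xW in auto)
  qed
  have xC: "x \<in> C" unfolding C_def by simp
  have Cadj: "d \<in> C" if "c \<in> C" "d \<in> W" "adj c d" for c d
  proof -
    have "step_in W c d" using that CW by blast
    then show ?thesis using that(1) unfolding C_def by (auto intro: rtranclp.rtrancl_into_rtrancl)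
  qed
  have Sv: "adj v s" if "s \<in> S" for s
  proof -
    have s: "s \<in> U - C" "\<exists>c\<in>C. adj c s" using that unfolding S_def by auto
    then obtain c where c: "c \<in> C" "adj c s" by blast
    have "s \<noteq> v" using c CW adj_sym unfolding W_def by blast
    moreover have "s \<notin> W" using Cadj[OF c(1) _ c(2)] s by blast
    ultimately show ?thesis using s unfolding W_def by blast
  qed
  have Cx: "(step_in C)\<^sup>*\<^sup>* x c" if "c \<in> C" for c
  proof -
    have "(step_in W)\<^sup>*\<^sup>* x c" using that unfolding C_def by simp
    then show ?thesis
    proof (induction rule: rtranclp_induct)
      case (step y z)
      then have "y \<in> C" unfolding C_def by simp
      moreover from this step have "z \<in> C" using Cadj by blast
      ultimately show ?case using step by (auto intro: rtranclp.rtrancl_into_rtrancl)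
    qed simp
  qed
  have Scl: "complete_on S"
    unfolding complete_on_def
  proof (intro ballI impI, rule ccontr)
    fix s t assume st: "s \<in> S" "t \<in> S" "s \<noteq> t" "\<not> adj s t"
    obtain c d where cd: "c \<in> C" "adj c s" "d \<in> C" "adj d t" using st(1,2) unfolding S_def by blast
    let ?T = "step_in (insert s (insert t C))"
    have "(step_in C)\<^sup>*\<^sup>* c d"
      using rtranclp_trans[OF step_in_rtranclp_sym[OF Cx[OF cd(1)]] Cx[OF cd(3)]] .
    then have "?T\<^sup>*\<^sup>* c d" by (rule step_in_rtranclp_mono) blast
    moreover have "?T\<^sup>*\<^sup>* s c" using cd(1) adj_sym[OF cd(2)] by (intro r_into_rtranclp) blast
    moreover have "?T\<^sup>*\<^sup>* d t" using cd(3,4) by (intro r_into_rtranclp) blast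
    ultimately have "?T\<^sup>*\<^sup>* s t" by (meson rtranclp_trans)
    then show False
      using hole_from_path[of s t C v] st(3,4) Sv[OF st(1)] Sv[OF st(2)] CW assms(1) unfolding W_def by blast
  qed
  define U' where "U' = C \<union> S"
  have U': "U' \<subseteq> U" "v \<notin> U'" using CW Sv adj_irrefl unfolding U'_def S_def W_def by auto
  then have card: "card U' < card U" using less.prems by (intro psubset_card_mono) auto
  have fin: "finite U'" using U' less.prems finite_subset by blast
  \<comment> \<open>A vertex of \<open>C\<close> has all its neighbours in
    \<open>C \<union> S\<close>, so the passage from \<open>U'\<close> back to \<open>U\<close> adds
    none.\<close>
  have simp_in_U: ?case if "z \<in> C" "complete_on (nbrs U' z)" for z
  proof -
    have "nbrs U z = nbrs U' z" using that(1) U' unfolding nbrs_def U'_def S_def by blast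
    then show ?thesis using that CW unfolding W_def by auto
  qed
  show ?case
  \<comment> \<open>The induction hypothesis yields a vertex not adjacent to a chosen one, and the
    choice must keep it out of \<open>S\<close>. Starting from \<open>s\<close> in \<open>S\<close>
    this holds as \<open>S\<close> is a clique; failing that, all of \<open>S\<close> is adjacent to
    everything, so a start in \<open>C\<close> works; failing both, \<open>U'\<close> is
    complete.\<close>
  proof (cases "\<exists>s\<in>S. \<exists>u\<in>U'. u \<noteq> s \<and> \<not> adj s u")
    case True
    then obtain s u where "s \<in> S" "u \<in> U'" "u \<noteq> s" "\<not> adj s u" by blast
    then obtain z where z: "z \<in> U'" "z \<noteq> s" "\<not> adj s z" "complete_on (nbrs U' z)"
      using less.hyps[OF card fin, of s u] unfolding U'_def by blast
    have "z \<notin> S" using complete_onD[OF Scl \<open>s \<in> S\<close>, of z] z(2,3) by blast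
    then show ?thesis using simp_in_U z unfolding U'_def by blast
  next
    case F1: False
    show ?thesis
    proof (cases "\<exists>c\<in>C. \<exists>u\<in>U'. u \<noteq> c \<and> \<not> adj c u")
      case True
      then obtain c u where c: "c \<in> C" "u \<in> U'" "u \<noteq> c" "\<not> adj c u" by blast
      then obtain z where z: "z \<in> U'" "z \<noteq> c" "\<not> adj c z" "complete_on (nbrs U' z)"
        using less.hyps[OF card fin, of c u] unfolding U'_def by blast
      have "c \<in> U'" using c(1) unfolding U'_def by blast
      have "z \<notin> S"
      proof
        assume "z \<in> S"
        then have "adj z c" using F1 \<open>c \<in> U'\<close> z(2) by metis
        then show False using z(3) adj_sym by metis
      qed
      then show ?thesis using simp_in_U z unfolding U'_def by blast
    next
      case False
      have "complete_on U'"
        unfolding complete_on_def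
      proof (intro ballI impI)
        fix a b assume ab: "a \<in> U'" "b \<in> U'" "a \<noteq> b"
        then have "a \<in> C \<or> a \<in> S" unfolding U'_def by blast
        then show "adj a b" using ab F1 False by metis
      qed
      then have "complete_on (nbrs U' x)" by (rule complete_on_subset) (auto simp: nbrs_def)
      then show ?thesis using simp_in_U xC by blast
    qed
  qed
qed

text \<open>A copy of \<open>k_tree 4\<close> on vertex sets over one fixed adjacency, so that
  inductions delete vertices without changing the ambient graph.\<close>

inductive four_tree :: "'a set \<Rightarrow> bool" where
  base: "card U = 4 \<Longrightarrow> complete_on U \<Longrightarrow> four_tree U"
| extend: "finite U \<Longrightarrow> u \<in> U \<Longrightarrow> complete_on (nbrs U u) \<Longrightarrow> card (nbrs U u) = 4 \<Longrightarrow>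
    four_tree (U - {u}) \<Longrightarrow> four_tree U"

lemma nbrs_subset: "nbrs U u \<subseteq> U - {u}"
  unfolding nbrs_def using adj_irrefl by blast

lemma four_tree_card: "four_tree U \<Longrightarrow> finite U \<and> 4 \<le> card U"
proof (induction rule: four_tree.induct)
  case (extend U u)
  then show ?case by (auto simp: card_Diff_singleton_if split: if_splits)
qed (auto simp: card_ge_0_finite)

text \<open>If \<open>D\<close> contains the vertex \<open>u\<close> added last, the rest of
  \<open>D\<close> is three of its four neighbours and the fourth completes \<open>D\<close>.
  Otherwise \<open>D\<close> lies in the smaller tree, or is all of it and \<open>u\<close> itself
  is the vertex sought.\<close>

lemma four_tree_4_clique:
  assumes "four_tree U" "D \<subseteq> U" "card D = 4" "complete_on D" "5 \<le> card U"
  shows "\<exists>w\<in>U - D. \<forall>d\<in>D. adj w d"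
  using assms
proof (induction arbitrary: D rule: four_tree.induct)
  case (extend U u)
  show ?case
  proof (cases "u \<in> D")
    case True
    have fD: "finite D" using extend.prems by (simp add: card_ge_0_finite)
    have D: "D - {u} \<subseteq> nbrs U u" using True extend.prems(1,3) unfolding nbrs_def complete_on_def by auto
    have "card (D - {u}) < card (nbrs U u)" using True extend.prems(2) extend.hyps(4) fD by simp
    then obtain w where w: "w \<in> nbrs U u" "w \<notin> D - {u}"
      using card_mono[of "D - {u}" "nbrs U u"] fD by (metis finite_Diff leD subsetI)
    then have "w \<noteq> u" "adj u w" "w \<in> U" using adj_irrefl[of u] unfolding nbrs_def by auto
    moreover have "adj w d" if "d \<in> D - {u}" for d
    proof (rule complete_onD[OF extend.hyps(3) w(1)])
      show "d \<in> nbrs U u" using that D by blast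
      show "w \<noteq> d" using that w(2) by blast
    qed
    ultimately show ?thesis using w(2) adj_sym[of u w] by blast
  next
    case False
    show ?thesis
    proof (cases "5 \<le> card (U - {u})")
      case True
      then show ?thesis using extend.IH[of D] extend.prems False by blast
    next
      case small: False
      have "card (U - {u}) = 4" using small four_tree_card[OF extend.hyps(5)] by linarith
      then have "D = U - {u}" using extend.prems False extend.hyps(1) by (intro card_subset_eq) auto
      moreover have "nbrs U u = U - {u}"
        using extend.hyps(1,4) \<open>card (U - {u}) = 4\<close> nbrs_subset by (intro card_subset_eq) auto
      ultimately have "\<forall>d\<in>D. adj u d" unfolding nbrs_def by blast
      then show ?thesis using False extend.hyps(2) by blast
    qed
  qed
qed auto

text \<open>If the last vertex \<open>u\<close> is in \<open>D\<close>, the other four extend to a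
  5-clique in the smaller tree by a vertex which need not be adjacent to \<open>u\<close>; hence 4
  rather than 5. This settles simplicial vertices of degree 5.\<close>

lemma four_tree_5_clique:
  assumes "four_tree U" "D \<subseteq> U" "card D = 5" "complete_on D" "6 \<le> card U"
  shows "\<exists>w\<in>U - D. 4 \<le> card {x \<in> D. adj w x}"
  using assms
proof (induction arbitrary: D rule: four_tree.induct)
  case (extend U u)
  have fD: "finite D" using extend.prems by (simp add: card_ge_0_finite)
  show ?case
  proof (cases "u \<in> D")
    case True
    let ?D = "D - {u}"
    have "card ?D = 4" using True extend.prems by simp
    moreover have "complete_on ?D" using extend.prems(3) by (rule complete_on_subset) blast
    moreover have "5 \<le> card (U - {u})" using extend.prems(4) extend.hyps(1,2) by simp
    ultimately obtain w where w: "w \<in> U - {u} - ?D" "\<forall>d\<in>?D. adj w d"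
      using four_tree_4_clique[OF extend.hyps(5), of ?D] extend.prems(1) by blast
    then have "card ?D \<le> card {x \<in> D. adj w x}" using fD by (intro card_mono) auto
    then show ?thesis using w \<open>card ?D = 4\<close> True by force
  next
    case False
    show ?thesis
    proof (cases "6 \<le> card (U - {u})")
      case True
      then show ?thesis using extend.IH[of D] extend.prems False by blast
    next
      case small: False
      have "card (U - {u}) = 5" using small extend.prems(4) extend.hyps(1,2) by simp
      then have "D = U - {u}" using extend.prems False extend.hyps(1) by (intro card_subset_eq) auto
      then have "{x \<in> D. adj u x} = nbrs U u" using adj_irrefl unfolding nbrs_def by blast
      then show ?thesis using extend.hyps(2,4) False by (intro bexI[of _ u]) auto
    qed
  qed
qed auto

section \<open>Simplicial vertices, connectedness and recognition of 4-trees\<close>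

lemma connected_on_remove_simplicial:
  assumes con: "connected_on X" and u: "complete_on (nbrs X u)"
  shows "connected_on (X - {u})"
  unfolding connected_on_def
proof (intro ballI)
  fix a b assume ab: "a \<in> X - {u}" "b \<in> X - {u}"
  let ?R = "(step_in (X - {u}))\<^sup>*\<^sup>*"
  have "(step_in X)\<^sup>*\<^sup>* a b" using con ab unfolding connected_on_def by blast
  \<comment> \<open>A walk that enters \<open>u\<close> may leave it towards any neighbour, so while
    it stands at \<open>u\<close> the invariant asks that all neighbours be reachable already; they
    are, being adjacent to the vertex before \<open>u\<close>.\<close>
  then have "(b \<noteq> u \<longrightarrow> ?R a b) \<and> (b = u \<longrightarrow> (\<forall>d\<in>nbrs X u. ?R a d))"
  proof (induction rule: rtranclp_induct)
    case base
    then show ?case using ab by simp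
  next
    case (step c d)
    have irr: "adj c d \<Longrightarrow> c \<noteq> d" using adj_irrefl by blast
    show ?case
    proof (cases "c = u")
      case True
      then have "d \<in> nbrs X u" "d \<noteq> u" using step.hyps(2) irr unfolding nbrs_def by auto
      then show ?thesis using step.IH True by blast
    next
      case c: False
      show ?thesis
      proof (cases "d = u")
        case True
        have cn: "c \<in> nbrs X u" using step.hyps(2) True adj_sym unfolding nbrs_def by blast
        have "?R a d'" if d': "d' \<in> nbrs X u" for d'
        proof (cases "d' = c")
          case False
          have "adj c d'" by (rule complete_onD[OF u cn d']) (use False in auto)
          moreover have "d' \<in> X - {u}" using d' nbrs_subset by blast
          ultimately have "step_in (X - {u}) c d'" using step.hyps(2) c by blast
          moreover have "?R a c" using step.IH c by blast
          ultimately show ?thesis by (intro rtranclp.rtrancl_into_rtrancl[of _ a c d'])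
        qed (use step.IH c in simp)
        then show ?thesis using True by blast
      next
        case False
        then have "step_in (X - {u}) c d" using step.hyps(2) c by blast
        moreover have "?R a c" using step.IH c by blast
        ultimately have "?R a d" by (intro rtranclp.rtrancl_into_rtrancl[of _ a c d])
        then show ?thesis using False by blast
      qed
    qed
  qed
  then show "?R a b" using ab by blast
qed

lemma nbrs_separate:
  assumes "u \<in> U" "v \<in> U" "v \<noteq> u" "\<not> adj u v"
  shows "\<not> connected_on (U - nbrs U u)"
proof
  assume "connected_on (U - nbrs U u)"
  moreover have "u \<in> U - nbrs U u" "v \<in> U - nbrs U u" using assms adj_irrefl unfolding nbrs_def by auto
  ultimately have "(step_in (U - nbrs U u))\<^sup>*\<^sup>* u v" unfolding connected_on_def by blast
  then obtain b where "step_in (U - nbrs U u) u b"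
    using assms(3) by (cases rule: converse_rtranclpE) auto
  then show False unfolding nbrs_def by blast
qed

lemma complete_four_tree:
  assumes "finite U" "complete_on U" "card U = 4 \<or> card U = 5"
  shows "four_tree U"
proof (cases "card U = 4")
  case False
  then obtain u where u: "u \<in> U" using assms by (metis card.empty equals0I zero_neq_numeral)
  have N: "nbrs U u = U - {u}"
    using u complete_onD[OF assms(2) u] nbrs_subset unfolding nbrs_def by auto
  have cl: "complete_on (U - {u})" by (rule complete_on_subset[OF assms(2)]) blast
  have card: "card (U - {u}) = 4" using False assms u by simp
  show ?thesis
    by (rule four_tree.extend[OF assms(1) u]) (use N cl card four_tree.base in simp_all)
qed (use assms in \<open>auto intro: four_tree.base\<close>)

lemma four_connected_four_tree:
  assumes holes: "\<And>p n. \<not> hole p n"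
    and apex: "\<And>K w. K \<subseteq> U \<Longrightarrow> card K = 6 \<Longrightarrow> complete_on K \<Longrightarrow> w \<in> U - K \<Longrightarrow> card {x \<in> K. adj w x} < 4"
    and U: "finite U" "4 \<le> card U"
    and con: "\<And>S. S \<subset> U \<Longrightarrow> card S \<le> 3 \<Longrightarrow> connected_on (U - S)"
  shows "four_tree U \<or> card U = 6 \<and> complete_on U"
  using apex U con
proof (induction "card U" arbitrary: U rule: less_induct)
  case less
  note apex = less.prems(1) and fin = less.prems(2) and card4 = less.prems(3) and con = less.prems(4)
  show ?case
  proof (cases "complete_on U")
    case True
    have "card U \<le> 6"
    proof (rule ccontr)
      assume "\<not> card U \<le> 6"
      then obtain K where K: "K \<subseteq> U" "card K = 6" by (metis nat_le_linear obtain_subset_with_card_n)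
      then have "K \<noteq> U" using \<open>\<not> card U \<le> 6\<close> by auto
      then obtain w where w: "w \<in> U - K" using K by blast
      have "adj w x" if "x \<in> K" for x using complete_onD[OF True, of w x] that K w by blast
      then have "{x \<in> K. adj w x} = K" by blast
      then show False using apex[OF K complete_on_subset[OF True K(1)] w] K(2) by simp
    qed
    then consider "card U = 4 \<or> card U = 5" | "card U = 6" using card4 by linarith
    then show ?thesis using complete_four_tree fin True by cases auto
  next
    case False
    then obtain v x where "v \<in> U" "x \<in> U" "x \<noteq> v" "\<not> adj v x" unfolding complete_on_def by metis
    then obtain u where u: "u \<in> U" "u \<noteq> v" "\<not> adj v u" "complete_on (nbrs U u)"
      using simplicial_vertex[OF holes fin] by blast
    have v: "v \<in> U" "v \<noteq> u" "\<not> adj u v" using \<open>v \<in> U\<close> u adj_sym by blast+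
    let ?N = "nbrs U u"
    have N: "?N \<subseteq> U" "u \<notin> ?N" "v \<notin> ?N" using adj_irrefl v(3) unfolding nbrs_def by auto
    have fN: "finite ?N" using N(1) fin finite_subset by blast
    have "4 \<le> card ?N"
    proof (rule ccontr)
      assume "\<not> 4 \<le> card ?N"
      then have "connected_on (U - ?N)" using con[of ?N] N u(1) by auto
      then show False using nbrs_separate[OF u(1) v] by blast
    qed
    moreover have "card ?N \<le> 5"
    proof (rule ccontr)
      assume "\<not> card ?N \<le> 5"
      then have "6 \<le> card ?N" by simp
      then obtain K where K: "K \<subseteq> ?N" "card K = 6" by (metis obtain_subset_with_card_n)
      then have "{x \<in> K. adj u x} = K" unfolding nbrs_def by blast
      moreover have "K \<subseteq> U" "u \<in> U - K" using K N u(1) by auto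
      ultimately show False using apex[of K u] K(2) complete_on_subset[OF u(4) K(1)] by simp
    qed
    \<comment> \<open>The non-neighbour \<open>v\<close> is the second vertex outside
      \<open>?N\<close>. With degree 5 this leaves six vertices after deleting \<open>u\<close>, as
      \<open>four_tree_5_clique\<close> requires.\<close>
    moreover have "card ?N + 2 = card (insert u (insert v ?N))" using N fN v by simp
    moreover have "card (insert u (insert v ?N)) \<le> card U" using N u(1) v(1) fin by (intro card_mono) auto
    ultimately have c: "card ?N = 4 \<or> card ?N = 5" "card ?N + 2 \<le> card U" by linarith+
    have U': "card (U - {u}) = card U - 1" using u(1) fin by simp
    have "four_tree (U - {u}) \<or> card (U - {u}) = 6 \<and> complete_on (U - {u})"
    proof (rule less.hyps)
      show "card (U - {u}) < card U" "4 \<le> card (U - {u})" using U' c by linarith+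
      show "card {x \<in> K. adj w x} < 4"
        if "K \<subseteq> U - {u}" "card K = 6" "complete_on K" "w \<in> U - {u} - K" for K w
        using apex[of K w] that by blast
      show "connected_on (U - {u} - S)" if S: "S \<subset> U - {u}" "card S \<le> 3" for S
      proof -
        have "connected_on (U - S)" using con[of S] S by blast
        moreover have "nbrs (U - S) u \<subseteq> ?N" unfolding nbrs_def by blast
        ultimately have "connected_on (U - S - {u})"
          using connected_on_remove_simplicial complete_on_subset[OF u(4)] by blast
        moreover have "U - {u} - S = U - S - {u}" by blast
        ultimately show ?thesis by simp
      qed
    qed (use fin in simp)
    \<comment> \<open>The other outcome of the induction hypothesis: \<open>u\<close> would be a
      seventh vertex with at least four neighbours in a K6.\<close>
    moreover have "\<not> (card (U - {u}) = 6 \<and> complete_on (U - {u}))"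
    proof
      assume K: "card (U - {u}) = 6 \<and> complete_on (U - {u})"
      have "?N \<subseteq> {x \<in> U - {u}. adj u x}" using N unfolding nbrs_def by blast
      then have "card ?N \<le> card {x \<in> U - {u}. adj u x}" using fin by (intro card_mono) auto
      moreover have "card {x \<in> U - {u}. adj u x} < 4" using K u(1) by (intro apex) auto
      ultimately show False using c by linarith
    qed
    ultimately have T: "four_tree (U - {u})" by blast
    have "card ?N \<noteq> 5"
    proof
      assume 5: "card ?N = 5"
      have "?N \<subseteq> U - {u}" by (rule nbrs_subset)
      moreover have "6 \<le> card (U - {u})" using c(2) U' 5 by linarith
      ultimately obtain w where w: "w \<in> U - {u} - ?N" "4 \<le> card {x \<in> ?N. adj w x}"
        using four_tree_5_clique[OF T _ 5 u(4)] by blast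
      have "{x \<in> ?N. adj w x} = {x \<in> insert u ?N. adj w x}"
        using w(1) adj_sym[of w u] unfolding nbrs_def by auto
      moreover have "card {x \<in> insert u ?N. adj w x} < 4"
      proof (rule apex)
        show "complete_on (insert u ?N)"
          using u(4) by (rule complete_on_insert) (simp add: nbrs_def)
      qed (use N u(1) fN 5 w(1) in auto)
      ultimately show False using w(2) by simp
    qed
    then have "four_tree U" using c(1) four_tree.extend[OF fin u(1,4) _ T] by blast
    then show ?thesis ..
  qed
qed

text \<open>If the vertex added last were adjacent to all others, the graph would be complete.
  Otherwise its four neighbours cut it off.\<close>

lemma four_tree_separator:
  assumes "four_tree U" "\<not> complete_on U"
  obtains S where "S \<subset> U" "card S = 4" "\<not> connected_on (U - S)"
  using assms(1)
proof cases
  case (extend u)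
  obtain v where v: "v \<in> U" "v \<noteq> u" "\<not> adj u v"
  proof (rule ccontr)
    assume n: "\<not> thesis"
    note goal = that
    have "adj u v" if "v \<in> U - {u}" for v using that n goal by blast
    then have "U = insert u (nbrs U u)" using extend(2) unfolding nbrs_def by blast
    moreover have "complete_on (insert u (nbrs U u))"
      using extend(3) by (rule complete_on_insert) (simp add: nbrs_def)
    ultimately show False using assms(2) by simp
  qed
  have "nbrs U u \<subset> U" using nbrs_subset[of U u] extend(2) by blast
  then show thesis using that nbrs_separate[OF extend(2) v] extend(4) by blast
qed (use assms(2) in simp)

end

section \<open>Drawings and separating sets of symmetric digraphs\<close>

lemma graph_simple_graph:
  assumes "graph G"
  shows "simple_graph (\<lambda>u v. u \<rightarrow>\<^bsub>G\<^esub> v)"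
proof -
  interpret graph G by fact
  show ?thesis
  proof
    show "v \<rightarrow>\<^bsub>G\<^esub> u" if "u \<rightarrow>\<^bsub>G\<^esub> v" for u v using that by (rule graph_symmetric)
    show "\<not> u \<rightarrow>\<^bsub>G\<^esub> u" for u using no_loops by (auto simp: arcs_ends_conv)
  qed
qed

lemma chordal_no_hole:
  assumes G: "graph G" and "chordal G"
  shows "\<not> simple_graph.hole (\<lambda>u v. u \<rightarrow>\<^bsub>G\<^esub> v) p n"
proof
  interpret graph G by fact
  interpret S: simple_graph "\<lambda>u v. u \<rightarrow>\<^bsub>G\<^esub> v" by (rule graph_simple_graph[OF G])
  assume "S.hole p n"
  then have n: "3 \<le> n" and inj: "inj_on p {..n}" and cl: "p n \<rightarrow>\<^bsub>G\<^esub> p 0"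
    and st: "\<And>i. i < n \<Longrightarrow> p i \<rightarrow>\<^bsub>G\<^esub> p (Suc i)"
    and ind: "\<And>i j. i < j \<Longrightarrow> j \<le> n \<Longrightarrow> p i \<rightarrow>\<^bsub>G\<^esub> p j \<Longrightarrow> j = Suc i \<or> i = 0 \<and> j = n"
    unfolding S.hole_def by blast+
  \<comment> \<open>The cyclic successor: arc \<open>a i\<close> leads from \<open>p i\<close> to
    \<open>nx i\<close>, and the last one back to \<open>p 0\<close>.\<close>
  define nx where "nx i = (if i = n then p 0 else p (Suc i))" for i
  have "\<exists>a. a \<in> arcs G \<and> tail G a = p i \<and> head G a = nx i" if "i \<le> n" for i
  proof -
    have "p i \<rightarrow>\<^bsub>G\<^esub> nx i" using cl st that unfolding nx_def by auto
    then show ?thesis by (auto simp: arcs_ends_conv)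
  qed
  then obtain a where a: "\<And>i. i \<le> n \<Longrightarrow> a i \<in> arcs G \<and> tail G (a i) = p i \<and> head G (a i) = nx i" by metis
  define L where "L = map a [0..<Suc n]"
  have "cas (p i) (map a [i..<Suc n]) (p 0)" if "i \<le> n" for i
    using that
  proof (induction rule: inc_induct)
    case base
    then show ?case using a[of n] by (simp add: nx_def)
  next
    case (step i)
    have "[i..<Suc n] = i # [Suc i..<Suc n]" using step.hyps by (simp add: upt_conv_Cons)
    then show ?case using step a[of i] by (simp add: nx_def del: upt_Suc)
  qed
  from this[of 0] have "cas (p 0) L (p 0)" unfolding L_def by simp
  moreover have L: "set L = a ` {..n}" unfolding L_def by (auto simp: atLeast0LessThan lessThan_Suc_atMost simp del: upt_Suc)
  moreover have "p 0 \<in> verts G" using cl by (rule adj_in_verts(2))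
  ultimately have aw: "awalk (p 0) L (p 0)" using a unfolding awalk_def by auto
  have "map (tail G) L = map p [0..<Suc n]" unfolding L_def using a by (simp del: upt_Suc)
  moreover have L0: "L \<noteq> []" "last L = a n" "length L = Suc n" unfolding L_def by simp_all
  moreover have "[0..<Suc n] = 0 # [Suc 0..<Suc n]" by (simp add: upt_conv_Cons del: upt_Suc)
  \<comment> \<open>The closed walk lists \<open>p 0\<close> at both ends, and a cycle must have
    distinct vertices after dropping the first entry.\<close>
  ultimately have "tl (awalk_verts (p 0) L) = map p [Suc 0..<Suc n] @ [p 0]"
    unfolding awalk_verts_conv using a[of n] by (simp add: nx_def del: upt_Suc)
  moreover have "distinct (map p [Suc 0..<Suc n] @ [p 0])"
  proof -
    have "inj_on p {Suc 0..<Suc n}" by (rule inj_on_subset[OF inj]) auto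
    moreover have "p 0 \<notin> p ` {Suc 0..<Suc n}"
      using inj_onD[OF inj, of 0] by fastforce
    ultimately show ?thesis by (simp add: distinct_map del: upt_Suc)
  qed
  ultimately have cyc: "cycle L" unfolding cycle_def using aw L0(1) by metis
  have "induced_cycle G L"
    unfolding induced_cycle_def
  proof (intro conjI ballI impI cyc)
    fix u v assume "u \<in> tail G ` set L" "v \<in> tail G ` set L" and uv: "u \<rightarrow>\<^bsub>G\<^esub> v"
    then obtain i j where ij: "i \<le> n" "j \<le> n" "u = p i" "v = p j" using L a by auto
    have ex: "\<exists>b\<in>set L. arc_to_ends G b \<in> {(p i, p j), (p j, p i)}"
      if "i < j" "j \<le> n" "p i \<rightarrow>\<^bsub>G\<^esub> p j" for i j
      using ind[OF that]
    proof
      assume "j = Suc i"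
      then show ?thesis using a[of i] that L by (intro bexI[of _ "a i"]) (auto simp: arc_to_ends_def nx_def)
    next
      assume "i = 0 \<and> j = n"
      then show ?thesis using a[of n] that L by (intro bexI[of _ "a n"]) (auto simp: arc_to_ends_def nx_def)
    qed
    have "i \<noteq> j" using uv ij S.adj_irrefl by blast
    then consider "i < j" | "j < i" by linarith
    then show "\<exists>b\<in>set L. arc_to_ends G b \<in> {(u, v), (v, u)}"
    proof cases
      case 1
      then show ?thesis using ex[of i j] uv ij by blast
    next
      case 2
      then show ?thesis using ex[of j i] S.adj_sym[OF uv] ij by blast
    qed
  qed
  moreover have "length L \<ge> 4" using n L0(3) by simp
  ultimately show False using \<open>chordal G\<close> unfolding chordal_def by blast
qed

lemma graph_induce_subgraph:
  assumes "graph G" and X: "X \<subseteq> verts G"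
  shows "graph (G \<restriction> X)"
proof -
  interpret graph G by fact
  have "symmetric (G \<restriction> X)" using induced_graph_imp_symmetric[OF sym_arcs] induced_induce X by blast
  then show ?thesis
    using X finite_subset[OF X] no_loops no_multi_arcs
    by unfold_locales (auto simp: arc_to_ends_def)
qed

lemma dominates_induce_subgraph_iff: "u \<rightarrow>\<^bsub>G \<restriction> X\<^esub> v \<longleftrightarrow> u \<rightarrow>\<^bsub>G\<^esub> v \<and> u \<in> X \<and> v \<in> X"
  by (auto simp: arcs_ends_conv)

lemma induce_subgraph_verts_self:
  assumes "graph (G :: ('a, 'b) pre_digraph)"
  shows "G \<restriction> verts G = G"
proof -
  interpret graph G by fact
  show ?thesis by (intro pre_digraph.equality) auto
qed

text \<open>In a symmetric digraph weak and strong connectedness agree. The contrapositive produces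
  separating sets.\<close>

lemma connected_connected_on:
  assumes G: "graph G" and X: "X \<subseteq> verts G" and con: "Digraph_Component.connected (G \<restriction> X)"
  shows "simple_graph.connected_on (\<lambda>u v. u \<rightarrow>\<^bsub>G\<^esub> v) X"
proof -
  interpret S: simple_graph "\<lambda>u v. u \<rightarrow>\<^bsub>G\<^esub> v" by (rule graph_simple_graph[OF G])
  interpret H: graph "G \<restriction> X" by (rule graph_induce_subgraph[OF G X])
  have sc: "strongly_connected (G \<restriction> X)"
    using H.symmetric_connected_imp_strongly_connected H.sym_arcs con by blast
  show ?thesis
    unfolding S.connected_on_def
  proof (intro ballI)
    fix a b assume "a \<in> X" "b \<in> X"
    then have "a \<rightarrow>\<^sup>*\<^bsub>G \<restriction> X\<^esub> b" using sc unfolding strongly_connected_def by simp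
    then have "(a, b) \<in> (arcs_ends (G \<restriction> X))\<^sup>*" unfolding reachable_def by (rule rtrancl_on_rtranclI)
    then show "(S.step_in X)\<^sup>*\<^sup>* a b"
    proof (induction rule: rtrancl_induct)
      case (step c d)
      then have "S.step_in X c d" by (simp add: dominates_induce_subgraph_iff)
      then show ?case using step.IH by (intro rtranclp.rtrancl_into_rtrancl[of _ a c d])
    qed simp
  qed
qed

lemma four_tree_k_tree:
  assumes G: "graph G" and "simple_graph.four_tree (\<lambda>u v. u \<rightarrow>\<^bsub>G\<^esub> v) X" "X \<subseteq> verts G"
  shows "k_tree 4 (G \<restriction> X)"
proof -
  interpret S: simple_graph "\<lambda>u v. u \<rightarrow>\<^bsub>G\<^esub> v" by (rule graph_simple_graph[OF G])
  show ?thesis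
    using assms(2,3)
  proof (induction rule: S.four_tree.induct)
    case (base U)
    have "arcs_ends (G \<restriction> U) = {(u, v). (u, v) \<in> U \<times> U \<and> u \<noteq> v}"
      using base.hyps(2) S.adj_irrefl S.complete_onD[OF base.hyps(2)]
      by (auto simp: dominates_induce_subgraph_iff)
    then show ?case
      using base graph_induce_subgraph[OF G] by (intro k_tree.complete) (simp add: complete_digraph_def)
  next
    case (extend U u)
    have N: "neighbourhood (G \<restriction> U) u = S.nbrs U u"
      using extend.hyps(2) unfolding neighbourhood_def S.nbrs_def by (auto simp: dominates_induce_subgraph_iff)
    have del: "pre_digraph.del_vert (G \<restriction> U) u = G \<restriction> (U - {u})"
      unfolding pre_digraph.del_vert_def induce_subgraph_def by auto
    show ?case
    proof (rule k_tree.extend)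
      show "graph (G \<restriction> U)" by (rule graph_induce_subgraph[OF G extend.prems])
      have "card U = Suc (card (U - {u}))" using extend.hyps(1,2) by (metis card_Suc_Diff1)
      then show "4 + 1 \<le> card (verts (G \<restriction> U))" using S.four_tree_card[OF extend.hyps(5)] by simp
      show "degree (G \<restriction> U) u = 4" unfolding degree_def N by (rule extend.hyps(4))
      show "simplicial (G \<restriction> U) u"
        using extend.hyps(2,3) S.nbrs_subset[of U u]
        unfolding simplicial_def clique_def N S.complete_on_def
        by (auto simp: dominates_induce_subgraph_iff)
      show "k_tree 4 (pre_digraph.del_vert (G \<restriction> U) u)" unfolding del using extend.IH extend.prems by blast
    qed
  qed
qed

section \<open>From drawings to the crossing relation\<close>

lemma edges_iff:
  assumes "graph G"
  shows "{u, v} \<in> edges G \<longleftrightarrow> u \<rightarrow>\<^bsub>G\<^esub> v"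
proof -
  interpret S: simple_graph "\<lambda>u v. u \<rightarrow>\<^bsub>G\<^esub> v" by (rule graph_simple_graph[OF assms])
  show ?thesis unfolding edges_def using S.adj_sym by (auto simp: doubleton_eq_iff)
qed

lemma crossing_points_commute: "crossing_points pos \<gamma> e f = crossing_points pos \<gamma> f e"
  unfolding crossing_points_def by (rule Int_commute)

lemma one_planar_one_plane:
  assumes G: "graph G" and "one_planar G"
  obtains pos E cr where "one_plane (verts G) (edges G) pos E cr"
proof -
  interpret graph G by fact
  obtain pos \<gamma> where good: "good_drawing G pos \<gamma>"
    and one: "\<And>e. e \<in> edges G \<Longrightarrow> finite (crossings G pos \<gamma> e) \<and> card (crossings G pos \<gamma> e) \<le> 1"
    using assms(2) unfolding one_planar_def by blast
  have dr: "inj_on pos (verts G)"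
    "\<And>e. e \<in> edges G \<Longrightarrow> Path_Connected.arc (\<gamma> e) \<and> {pathstart (\<gamma> e), pathfinish (\<gamma> e)} = pos ` e \<and>
        path_image (\<gamma> e) \<inter> pos ` verts G = pos ` e"
    using good unfolding good_drawing_def drawing_def by blast+
  have X: "finite (crossing_points pos \<gamma> e f)" "card (crossing_points pos \<gamma> e f) \<le> 1"
    "e \<inter> f \<noteq> {} \<Longrightarrow> crossing_points pos \<gamma> e f = {}" if "e \<in> edges G" "f \<in> edges G" "e \<noteq> f" for e f
    using good that unfolding good_drawing_def by blast+
  define E where "E e = path_image (\<gamma> e)" for e
  define cr where "cr e f \<longleftrightarrow> e \<in> edges G \<and> f \<in> edges G \<and> e \<noteq> f \<and> crossing_points pos \<gamma> e f \<noteq> {}" for e f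
  have ev: "e \<subseteq> verts G" "\<exists>u v. e = {u, v}" if "e \<in> edges G" for e
    using that adj_in_verts unfolding edges_def by auto
  \<comment> \<open>Curves meet no vertices but their own ends, so a shared vertex point comes from
    a shared end.\<close>
  have common: "p \<in> pos ` (e \<inter> f) \<or> p \<in> crossing_points pos \<gamma> e f"
    if ef: "e \<in> edges G" "f \<in> edges G" and p: "p \<in> E e" "p \<in> E f" for e f p
  proof (cases "p \<in> pos ` verts G")
    case True
    then have "p \<in> pos ` e" "p \<in> pos ` f" using dr(2) ef p unfolding E_def by blast+
    moreover have "pos ` e \<inter> pos ` f = pos ` (e \<inter> f)"
      using inj_on_image_Int[OF dr(1)] ev ef by metis
    ultimately show ?thesis by blast
  next
    case False
    then have "p \<notin> pos ` e" "p \<notin> pos ` f" using ev(1) ef by blast+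
    then show ?thesis using p unfolding crossing_points_def E_def by blast
  qed
  have notvert: "p \<notin> pos ` verts G" if "e \<in> edges G" "p \<in> crossing_points pos \<gamma> e f" for e f p
    using that dr(2)[OF that(1)] unfolding crossing_points_def by blast
  have dis: "e \<inter> f = {}" if "cr e f" for e f using that X(3) unfolding cr_def by blast
  show thesis
  proof (rule that, rule one_plane.intro)
    show "inj_on pos (verts G)" by (rule dr(1))
    show "e \<subseteq> verts G" "\<exists>u v. e = {u, v}" if "e \<in> edges G" for e using ev[OF that] .
    show "link (pos u) (pos v) (E {u, v})" if "{u, v} \<in> edges G" for u v
    proof -
      have "{pathstart (\<gamma> {u, v}), pathfinish (\<gamma> {u, v})} = {pos u, pos v}" using dr(2)[OF that] by simp
      \<comment> \<open>Edges are unordered sets, so the curve may run in either direction.\<close>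
      then have "pathstart (\<gamma> {u, v}) = pos u \<and> pathfinish (\<gamma> {u, v}) = pos v \<or>
          pathstart (\<gamma> {u, v}) = pos v \<and> pathfinish (\<gamma> {u, v}) = pos u" by (auto simp: doubleton_eq_iff)
      moreover have "link (pathstart (\<gamma> {u, v})) (pathfinish (\<gamma> {u, v})) (E {u, v})"
        unfolding link_def E_def using dr(2)[OF that] by (intro exI[of _ "\<gamma> {u, v}"]) simp
      ultimately show ?thesis using link_sym[of "pos v" "pos u"] by auto
    qed
    show "E e \<inter> pos ` verts G = pos ` e" if "e \<in> edges G" for e using dr(2)[OF that] unfolding E_def by blast
    show "e \<in> edges G \<and> f \<in> edges G \<and> e \<inter> f = {}" if "cr e f" for e f
      using that dis[OF that] unfolding cr_def by blast
    show "cr f e" if "cr e f" for e f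
      using that crossing_points_commute[of pos \<gamma> f e] unfolding cr_def by auto
    show "f = g" if c: "cr e f" "cr e g" for e f g
    proof -
      obtain x y where "x \<in> crossing_points pos \<gamma> e f" "y \<in> crossing_points pos \<gamma> e g"
        using c unfolding cr_def by blast
      \<comment> \<open>Crossings are recorded together with the other edge, so two edges through
        one point still count as two.\<close>
      then have "(f, x) \<in> crossings G pos \<gamma> e" "(g, y) \<in> crossings G pos \<gamma> e"
        using c unfolding crossings_def cr_def by auto
      moreover have "card (crossings G pos \<gamma> e) \<le> 1" "finite (crossings G pos \<gamma> e)"
        using one c(1) unfolding cr_def by blast+
      ultimately show ?thesis by (metis One_nat_def card_le_Suc0_iff_eq prod.inject)
    qed
    show "\<exists>x. E e \<inter> E f = {x} \<and> x \<notin> pos ` verts G" if c: "cr e f" for e f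
    proof -
      have ef: "e \<in> edges G" "f \<in> edges G" "e \<noteq> f" using c unfolding cr_def by blast+
      obtain x where x: "x \<in> crossing_points pos \<gamma> e f" using c unfolding cr_def by blast
      have "p = x" if "p \<in> E e \<inter> E f" for p
      proof -
        have "p \<in> crossing_points pos \<gamma> e f" using common[OF ef(1,2)] that dis[OF c] by blast
        then show ?thesis using x X(1,2)[OF ef] by (metis One_nat_def card_le_Suc0_iff_eq)
      qed
      moreover have "x \<in> E e \<inter> E f" using x unfolding crossing_points_def E_def by blast
      ultimately show ?thesis using notvert[OF ef(1) x] by blast
    qed
    show "E e \<inter> E f \<subseteq> pos ` (e \<inter> f)" if "e \<in> edges G" "f \<in> edges G" "e \<noteq> f" "\<not> cr e f" for e f
      using common[OF that(1,2)] that unfolding cr_def by blast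
  qed
qed

lemma one_planar_K6_apex:
  assumes G: "graph G" and "one_planar G"
    and K: "card K = 6" "simple_graph.complete_on (\<lambda>u v. u \<rightarrow>\<^bsub>G\<^esub> v) K" "w \<notin> K"
  shows "card {x \<in> K. w \<rightarrow>\<^bsub>G\<^esub> x} < 4"
proof (rule ccontr)
  assume "\<not> card {x \<in> K. w \<rightarrow>\<^bsub>G\<^esub> x} < 4"
  interpret S: simple_graph "\<lambda>u v. u \<rightarrow>\<^bsub>G\<^esub> v" by (rule graph_simple_graph[OF G])
  obtain pos E cr where "one_plane (verts G) (edges G) pos E cr"
    using one_planar_one_plane[OF assms(1,2)] .
  then interpret P: one_plane "verts G" "edges G" pos E cr .
  have "P.K6 K" using K unfolding P.K6_def S.complete_on_def edges_iff[OF G] by blast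
  then show False
    using P.K6_no_apex[of K w] K(3) \<open>\<not> card {x \<in> K. w \<rightarrow>\<^bsub>G\<^esub> x} < 4\<close> unfolding edges_iff[OF G] by simp
qed

theorem proposition1:
  fixes G :: "('a, 'b) pre_digraph"
  assumes "graph G" and "Digraph_Component.connected G"
    and "one_planar G" and "chordal G" and "\<not> K\<^bsub>6\<^esub> G"
  shows "connectivity G \<le> 4 \<and> (connectivity G = 4 \<longrightarrow> k_tree 4 G)"
proof -
  interpret graph G by fact
  interpret S: simple_graph "\<lambda>u v. u \<rightarrow>\<^bsub>G\<^esub> v" by (rule graph_simple_graph[OF assms(1)])
  let ?V = "verts G"
  note holes = chordal_no_hole[OF assms(1,4)]
  note apex = one_planar_K6_apex[OF assms(1,3)]
  have complete: "K\<^bsub>card ?V\<^esub> G \<longleftrightarrow> S.complete_on ?V"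
  proof
    show "K\<^bsub>card ?V\<^esub> G" if "S.complete_on ?V"
      unfolding complete_digraph_def
    proof (intro conjI assms(1) refl)
      show "arcs_ends G = {(u, v). (u, v) \<in> ?V \<times> ?V \<and> u \<noteq> v}"
      proof (rule set_eqI)
        fix e :: "'a \<times> 'a"
        obtain u v where "e = (u, v)" by fastforce
        then show "e \<in> arcs_ends G \<longleftrightarrow> e \<in> {(u, v). (u, v) \<in> ?V \<times> ?V \<and> u \<noteq> v}"
          using S.complete_onD[OF that, of u v] S.adj_irrefl[of u] adj_in_verts[of u v] by auto
      qed
    qed
    show "S.complete_on ?V" if "K\<^bsub>card ?V\<^esub> G"
    proof -
      have "arcs_ends G = {(u, v). (u, v) \<in> ?V \<times> ?V \<and> u \<noteq> v}" using that unfolding complete_digraph_def by blast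
      then show ?thesis unfolding S.complete_on_def by simp
    qed
  qed
  have sep: "separating G T" if "T \<subset> ?V" "\<not> S.connected_on (?V - T)" for T
    using that connected_connected_on[OF assms(1) Diff_subset, of T] unfolding separating_def by blast
  have tree: "S.four_tree ?V"
    if card: "4 \<le> card ?V" and con: "\<And>T. T \<subset> ?V \<Longrightarrow> card T \<le> 3 \<Longrightarrow> \<not> separating G T"
  proof -
    have "S.four_tree ?V \<or> card ?V = 6 \<and> S.complete_on ?V"
    proof (rule S.four_connected_four_tree)
      show "S.connected_on (?V - T)" if "T \<subset> ?V" "card T \<le> 3" for T using sep con that by blast
    qed (use holes apex card in auto)
    then show ?thesis using complete assms(5) by auto
  qed
  have k_tree: "k_tree 4 G" if "S.four_tree ?V"
    using four_tree_k_tree[OF assms(1) that] induce_subgraph_verts_self[OF assms(1)] by simp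
  show ?thesis
  proof (cases "S.complete_on ?V")
    case True
    then have kappa: "connectivity G = card ?V - 1" unfolding connectivity_def using complete by simp
    have "card ?V \<le> 6"
    proof (rule ccontr)
      assume "\<not> card ?V \<le> 6"
      then obtain K where K: "K \<subseteq> ?V" "card K = 6" by (metis nat_le_linear obtain_subset_with_card_n)
      then have "K \<noteq> ?V" using \<open>\<not> card ?V \<le> 6\<close> by auto
      then obtain w where w: "w \<in> ?V" "w \<notin> K" using K by blast
      have "w \<rightarrow>\<^bsub>G\<^esub> x" if "x \<in> K" for x
        using S.complete_onD[OF True, of w x] that K(1) w by blast
      then have "{x \<in> K. w \<rightarrow>\<^bsub>G\<^esub> x} = K" by blast
      then show False using apex[OF K(2) S.complete_on_subset[OF True K(1)] w(2)] K(2) by simp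
    qed
    moreover have "card ?V \<noteq> 6" using complete True assms(5) by auto
    ultimately have "card ?V \<le> 5" by linarith
    \<comment> \<open>Among complete graphs only K5 has connectivity 4.\<close>
    moreover have "k_tree 4 G" if "card ?V = 5"
      using k_tree S.complete_four_tree[OF finite_verts True] that by simp
    ultimately show ?thesis unfolding kappa by auto
  next
    case False
    then have kappa: "connectivity G = (LEAST k. \<exists>T. separating G T \<and> card T = k)"
      unfolding connectivity_def using complete by simp
    have le: "connectivity G \<le> card T" if "separating G T" for T
      unfolding kappa using that by (intro Least_le) blast
    \<comment> \<open>Assuming only a lower bound lets the result serve twice: a non-complete 4-tree
      has a separating set of size 4, which gives the upper bound, and the case of equality follows
      as well.\<close>
    have tree': "S.four_tree ?V" if k: "4 \<le> connectivity G"
    proof (rule tree)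
      obtain u v where uv: "u \<in> ?V" "v \<in> ?V" "v \<noteq> u" "\<not> u \<rightarrow>\<^bsub>G\<^esub> v"
        using False unfolding S.complete_on_def by metis
      \<comment> \<open>The neighbourhood of \<open>u\<close> cuts it off from \<open>v\<close>;
        this separating set has at least 4 elements, which bounds the order of the graph from
        below.\<close>
      have "separating G (S.nbrs ?V u)"
        using S.nbrs_separate[OF uv] S.nbrs_subset[of ?V u] uv(1) by (intro sep) auto
      then have "4 \<le> card (S.nbrs ?V u)" using le k by fastforce
      also have "\<dots> \<le> card ?V" by (intro card_mono) (auto simp: S.nbrs_def)
      finally show "4 \<le> card ?V" .
      show "\<not> separating G T" if "card T \<le> 3" for T using le[of T] k that by auto
    qed
    have "connectivity G \<le> 4"
    proof (cases "4 \<le> connectivity G")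
      case True
      obtain T where "T \<subset> ?V" "card T = 4" "\<not> S.connected_on (?V - T)"
        using S.four_tree_separator[OF tree'[OF True] False] .
      then show ?thesis using le[OF sep[of T]] by simp
    qed simp
    then show ?thesis using tree' k_tree by auto
  qed
qed

end
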